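(* Let $\delta_{xy},\delta_{xz},p_0,p_1\in\mathrm{Fmd}_3$ be arbitrary formulas, where the free variables of $\delta_{xy}$ are among $x,y$, those of $\delta_{xz}$ among $x,z$, and those of $p_0,p_1$ among $x,y$; and let $\mathrm{Ax}$, $\mathsf{D}_{ra}=\langle D_{ra},+,-,;,\breve{\ },\mathrm{id}\rangle$ and $\equiv_{\mathrm{Ax}}$ be defined from these parameters as in the context. Then: (i) $D_{ra}$ is closed under the operations $+,-,;,\breve{\ }$ and contains $\mathrm{id}$, so $\mathsf{D}_{ra}$ is an algebra; (ii) $D_{ra}\supseteq\{\varphi;\psi:\varphi,\psi\in\mathrm{Fmd}^1_3\}$; (iii) the quotient $\mathsf{D}_{ra}/\!\equiv_{\mathrm{Ax}}$ is a relation algebra; (iv) the $\equiv_{\mathrm{Ax}}$-classes $\mathsf p$ and $\mathsf q$ of the formulas $x_1\doteq x_{00}$ and $x_1\doteq x_{01}$ form a quasi-projection pair in $\mathsf{D}_{ra}/\!\equiv_{\mathrm{Ax}}$, i.e. $\mathsf p\breve{\ };\mathsf p+\mathsf q\breve{\ };\mathsf q\le 1'$ and $\mathsf p\breve{\ };\mathsf q$ is the top element $1'+-1'$.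
   Context: The logic $\mathcal{L}d_3$: variables $x,y,z$, one ternary relation symbol $P$, exactly one atomic formula $P(x,y,z)$ (no equality, no other atomic formulas); $\mathrm{Fmd}_3$ is the set of formulas built from $P(x,y,z)$ by $\vee,\neg,\exists x,\exists y,\exists z$, with the usual abbreviations $\forall,\wedge,\to,\leftrightarrow$; inside formulas a comma denotes conjunction. The proof system $\vdash$ has axioms, for all $\varphi,\psi\in\mathrm{Fmd}_3$, $v,w\in\{x,y,z\}$: (1) propositional tautologies; (2) $\forall v(\varphi\to\psi)\to(\exists v\varphi\to\exists v\psi)$; (3) $\varphi\to\exists v\varphi$; (4) $\exists v\exists v\varphi\to\exists v\varphi$; (5) $\exists v(\varphi\vee\psi)\leftrightarrow(\exists v\varphi\vee\exists v\psi)$; (6) $\exists v\neg\exists v\varphi\to\neg\exists v\varphi$; (7) $\exists v\exists w\varphi\to\exists w\exists v\varphi$; rules Modus Ponens and Generalization. $T\vdash\varphi$ means derivable from the axioms and $T$. For $T\subseteq\mathrm{Fmd}_3$, $\varphi\equiv_T\psi$ iff $T\vdash\varphi\leftrightarrow\psi$. $\mathrm{Fmd}^1_3$ is the set of formulas of $\mathrm{Fmd}_3$ with free variables among $\{x\}$. $\mathrm{True}:=\delta_{xy}\vee\neg\delta_{xy}$. Simulated equality: $e_{xy}:=\delta_{xy}$, $e_{xz}:=\delta_{xz}$, $e_{yz}:=\exists x(e_{xy}\wedge e_{xz})$, $e_{yx}:=e_{xy}$, $e_{zx}:=e_{xz}$, $e_{zy}:=e_{yz}$, $e_{xx}=e_{yy}=e_{zz}:=\mathrm{True}$.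 Simulated substitution, for $\varphi\in\mathrm{Fmd}_3$: $\varphi\langle x,y\rangle:=\varphi$; $\varphi\langle x,z\rangle:=\exists y(e_{yz},\varphi)$; $\varphi\langle y,z\rangle:=\exists x(e_{xy},\varphi\langle x,z\rangle)$; $\varphi\langle y,x\rangle:=\exists z(e_{xz},\varphi\langle y,z\rangle)$; $\varphi\langle z,x\rangle:=\exists y(e_{yz},\varphi\langle y,x\rangle)$; $\varphi\langle z,y\rangle:=\exists x(e_{xz},\varphi)$; $\varphi\langle x,x\rangle:=\exists y(e_{xy},\varphi)$; $\varphi\langle y,y\rangle:=\exists x(e_{xy},\varphi)$; $\varphi\langle z,z\rangle:=\exists x(e_{xz},\varphi\langle x,x\rangle)$. Let $2^*$ be the set of finite $0$-$1$ sequences (including the empty sequence $\emptyset$), $ij$ concatenation, $|i|$ length, and $k\in\{0,1\}$ identified with the length-1 sequence. Formulas $u_i\doteq v_j$ ($u,v\in\{x,y,z\}$, $i,j\in 2^*$) are defined as follows, where in the first four clauses $u,v,w$ are pairwise distinct with $\{u,v,w\}=\{x,y,z\}$ and $k\in\{0,1\}$: $(u_\emptyset\doteq v_\emptyset):=e_{uv}$; $(u_k\doteq v_\emptyset):=p_k\langle u,v\rangle$; $(u_{ik}\doteq v_\emptyset):=\exists w(u_i\doteq w_\emptyset,\ p_k\langle w,v\rangle)$ if $i\ne\emptyset$; $(u_i\doteq v_j):=\exists w(u_i\doteq w_\emptyset,\ v_j\doteq w_\emptyset)$ if $j\neq\emptyset$; and $(x_i\doteq x_j):=\exists y(e_{xy},x_i\doteq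 y_j)$, $(y_i\doteq y_j):=\exists x(e_{xy},x_i\doteq y_j)$, $(z_i\doteq z_j):=\exists x(z_i\doteq x_\emptyset, z_j\doteq x_\emptyset)$. The subscript $\emptyset$ is omitted (e.g. $u\doteq v_i$ means $u_\emptyset\doteq v_i$). Let $H=\{i\in 2^*:|i|\le 3\}$. $\mathrm{Ax}$ is the conjunction of all formulas in: (A1) $u_i\doteq v_j\wedge v_j\doteq w_k\to u_i\doteq w_k$ for $u,v,w\in\{x,y,z\}$, $i,j,k\in H$; (A2) $u_i\doteq v_j\wedge u_{ik}\doteq u_{ik}\to u_{ik}\doteq v_{jk}$ for $u,v\in\{x,y,z\}$, $k\in\{0,1\}$, $ik,jk\in H$; (A3) $u_i\doteq u_i\wedge v_j\doteq v_j\to\exists w(w_0\doteq u_i, w_1\doteq v_j)$ for $u,v,w\in\{x,y,z\}$, $w\notin\{u,v\}$, $i,j\in H$; (A4) $\exists w\,(u\doteq w)$ for $u,w\in\{x,y,z\}$. Operations: $\mathrm{pair}:=\exists y\,p_0\wedge\exists y\,p_1$; for $u\in\{y,z\}$, $i\in 2^*$: $\varphi u_i:=\exists x(x\doteq u_i,\varphi)$; $\varphi;\psi:=\exists y(\varphi y_0,\ \psi y_1,\ x_0\doteq y_{00},\ y_{01}\doteq y_{10},\ y_{11}\doteq x_1)$; $\varphi\breve{\ }:=\exists y(\varphi y,\ y_0\doteq x_1,\ y_1\doteq x_0)$; $\mathrm{id}:=x_0\doteq x_1$; $-\varphi:=\mathrm{pair}\wedge\neg\varphi$; $\varphi+\psi:=\varphi\vee\psi$.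 $D_{ra}:=\{\varphi\in\mathrm{Fmd}_3:\mathrm{Ax}\vdash\varphi\leftrightarrow\psi;\mathrm{id}$ for some $\psi\in\mathrm{Fmd}^1_3\}$ and $\mathsf D_{ra}=\langle D_{ra},+,-,;,\breve{\ },\mathrm{id}\rangle$; the identity constant of the quotient is denoted $1'$. A relation algebra is an algebra $\langle A,+,-,;,\breve{\ },1'\rangle$ such that $\langle A,+,-\rangle$ is a Boolean algebra, $;$ is associative, $(a+b);c=a;c+b;c$, $a;1'=a$, $a\breve{\ }\breve{\ }=a$, $(a+b)\breve{\ }=a\breve{\ }+b\breve{\ }$, $(a;b)\breve{\ }=b\breve{\ };a\breve{\ }$, and $a\breve{\ };-(a;b)\le -b$ (Tarski's axioms). *)

theory Defs
  imports Main
begin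

section \<open>The three-variable logic with one atomic formula\<close>

datatype var = VX | VY | VZ

datatype fmd3 =
    Atm  \<comment> \<open>\<open>P(x,y,z)\<close>\<close>
  | Or fmd3 fmd3  (infixr "\<^bold>\<or>" 60)
  | Neg fmd3  ("\<^bold>\<not> _" [70] 70)
  | Ex var fmd3

definition And :: "fmd3 \<Rightarrow> fmd3 \<Rightarrow> fmd3"  (infixr "\<^bold>\<and>" 65) where
  "\<phi> \<^bold>\<and> \<psi> = \<^bold>\<not> (\<^bold>\<not> \<phi> \<^bold>\<or> \<^bold>\<not> \<psi>)"

definition Imp :: "fmd3 \<Rightarrow> fmd3 \<Rightarrow> fmd3"  (infixr "\<^bold>\<longrightarrow>" 55) where
  "\<phi> \<^bold>\<longrightarrow> \<psi> = \<^bold>\<not> \<phi> \<^bold>\<or> \<psi>"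

definition Iff :: "fmd3 \<Rightarrow> fmd3 \<Rightarrow> fmd3"  (infixr "\<^bold>\<longleftrightarrow>" 50) where
  "(\<phi> \<^bold>\<longleftrightarrow> \<psi>) = (\<phi> \<^bold>\<longrightarrow> \<psi>) \<^bold>\<and> (\<psi> \<^bold>\<longrightarrow> \<phi>)"

definition All :: "var \<Rightarrow> fmd3 \<Rightarrow> fmd3" where
  "All v \<phi> = \<^bold>\<not> Ex v (\<^bold>\<not> \<phi>)"

primrec fv :: "fmd3 \<Rightarrow> var set" where
  "fv Atm = {VX, VY, VZ}"
| "fv (\<phi> \<^bold>\<or> \<psi>) = fv \<phi> \<union> fv \<psi>"
| "fv (\<^bold>\<not> \<phi>) = fv \<phi>"
| "fv (Ex v \<phi>) = fv \<phi> - {v}"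

definition Fmd1 :: "fmd3 set" where
  "Fmd1 = {\<phi>. fv \<phi> \<subseteq> {VX}}"

text \<open>Propositional evaluation: the atomic formula and the existentially quantified formulas
  play the role of propositional letters.\<close>

primrec prop_eval :: "(fmd3 \<Rightarrow> bool) \<Rightarrow> fmd3 \<Rightarrow> bool" where
  "prop_eval h Atm = h Atm"
| "prop_eval h (\<phi> \<^bold>\<or> \<psi>) = (prop_eval h \<phi> \<or> prop_eval h \<psi>)"
| "prop_eval h (\<^bold>\<not> \<phi>) = (\<not> prop_eval h \<phi>)"
| "prop_eval h (Ex v \<phi>) = h (Ex v \<phi>)"

definition tautology :: "fmd3 \<Rightarrow> bool" where
  "tautology \<phi> \<longleftrightarrow> (\<forall>h. prop_eval h \<phi>)"

inductive derivable :: "fmd3 set \<Rightarrow> fmd3 \<Rightarrow> bool"  (infix "\<turnstile>" 45) for T :: "fmd3 set" where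
  hyp: "\<phi> \<in> T \<Longrightarrow> T \<turnstile> \<phi>"
| ax1: "tautology \<phi> \<Longrightarrow> T \<turnstile> \<phi>"
| ax2: "T \<turnstile> All v (\<phi> \<^bold>\<longrightarrow> \<psi>) \<^bold>\<longrightarrow> (Ex v \<phi> \<^bold>\<longrightarrow> Ex v \<psi>)"
| ax3: "T \<turnstile> \<phi> \<^bold>\<longrightarrow> Ex v \<phi>"
| ax4: "T \<turnstile> Ex v (Ex v \<phi>) \<^bold>\<longrightarrow> Ex v \<phi>"
| ax5: "T \<turnstile> Ex v (\<phi> \<^bold>\<or> \<psi>) \<^bold>\<longleftrightarrow> (Ex v \<phi> \<^bold>\<or> Ex v \<psi>)"
| ax6: "T \<turnstile> Ex v (\<^bold>\<not> Ex v \<phi>) \<^bold>\<longrightarrow> \<^bold>\<not> Ex v \<phi>"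
| ax7: "T \<turnstile> Ex v (Ex w \<phi>) \<^bold>\<longrightarrow> Ex w (Ex v \<phi>)"
| mp: "T \<turnstile> \<phi> \<Longrightarrow> T \<turnstile> \<phi> \<^bold>\<longrightarrow> \<psi> \<Longrightarrow> T \<turnstile> \<psi>"
| gen: "T \<turnstile> \<phi> \<Longrightarrow> T \<turnstile> All v \<phi>"

definition prov_eq :: "fmd3 set \<Rightarrow> (fmd3 \<times> fmd3) set" where
  "prov_eq T = {(\<phi>, \<psi>). T \<turnstile> \<phi> \<^bold>\<longleftrightarrow> \<psi>}"


section \<open>Simulated equality, substitution and pairing\<close>

record params =
  delta_xy :: fmd3
  delta_xz :: fmd3
  proj0 :: fmd3
  proj1 :: fmd3

definition True_fm :: "params \<Rightarrow> fmd3" where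
  "True_fm \<Delta> = delta_xy \<Delta> \<^bold>\<or> \<^bold>\<not> delta_xy \<Delta>"

fun sim_eq :: "params \<Rightarrow> var \<Rightarrow> var \<Rightarrow> fmd3" where
  "sim_eq \<Delta> VX VY = delta_xy \<Delta>"
| "sim_eq \<Delta> VX VZ = delta_xz \<Delta>"
| "sim_eq \<Delta> VY VZ = Ex VX (delta_xy \<Delta> \<^bold>\<and> delta_xz \<Delta>)"
| "sim_eq \<Delta> VY VX = delta_xy \<Delta>"
| "sim_eq \<Delta> VZ VX = delta_xz \<Delta>"
| "sim_eq \<Delta> VZ VY = Ex VX (delta_xy \<Delta> \<^bold>\<and> delta_xz \<Delta>)"
| "sim_eq \<Delta> VX VX = True_fm \<Delta>"
| "sim_eq \<Delta> VY VY = True_fm \<Delta>"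
| "sim_eq \<Delta> VZ VZ = True_fm \<Delta>"

function sim_sub :: "params \<Rightarrow> fmd3 \<Rightarrow> var \<Rightarrow> var \<Rightarrow> fmd3" where
  "sim_sub \<Delta> \<phi> VX VY = \<phi>"
| "sim_sub \<Delta> \<phi> VX VZ = Ex VY (sim_eq \<Delta> VY VZ \<^bold>\<and> \<phi>)"
| "sim_sub \<Delta> \<phi> VY VZ = Ex VX (sim_eq \<Delta> VX VY \<^bold>\<and> sim_sub \<Delta> \<phi> VX VZ)"
| "sim_sub \<Delta> \<phi> VY VX = Ex VZ (sim_eq \<Delta> VX VZ \<^bold>\<and> sim_sub \<Delta> \<phi> VY VZ)"
| "sim_sub \<Delta> \<phi> VZ VX = Ex VY (sim_eq \<Delta> VY VZ \<^bold>\<and> sim_sub \<Delta> \<phi> VY VX)"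
| "sim_sub \<Delta> \<phi> VZ VY = Ex VX (sim_eq \<Delta> VX VZ \<^bold>\<and> \<phi>)"
| "sim_sub \<Delta> \<phi> VX VX = Ex VY (sim_eq \<Delta> VX VY \<^bold>\<and> \<phi>)"
| "sim_sub \<Delta> \<phi> VY VY = Ex VX (sim_eq \<Delta> VX VY \<^bold>\<and> \<phi>)"
| "sim_sub \<Delta> \<phi> VZ VZ = Ex VX (sim_eq \<Delta> VX VZ \<^bold>\<and> sim_sub \<Delta> \<phi> VX VX)"
  by (pat_completeness) auto
termination
  by (relation "measure (\<lambda>(\<Delta>, \<phi>, u, v).
        if (u, v) = (VZ, VX) then 3 else if (u, v) = (VY, VX) then 2
        else if (u, v) = (VY, VZ) \<or> (u, v) = (VZ, VZ) then 1 else 0)") auto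

text \<open>Finite 0-1 sequences are lists of Booleans, \<open>False\<close> standing for 0 and \<open>True\<close> for 1.\<close>

definition proj :: "params \<Rightarrow> bool \<Rightarrow> fmd3" where
  "proj \<Delta> k = (if k then proj1 \<Delta> else proj0 \<Delta>)"

text \<open>For \<open>u \<noteq> v\<close> this is the unique \<open>w\<close> with \<open>{u, v, w} = {VX, VY, VZ}\<close>.\<close>

definition third :: "var \<Rightarrow> var \<Rightarrow> var" where
  "third u v = (if VX \<notin> {u, v} then VX else if VY \<notin> {u, v} then VY else VZ)"

text \<open>The formula \<open>u\<^sub>i \<doteq> v\<close> with empty index on the right, for distinct \<open>u, v\<close>; the recursion
  removes the last entry of the index.\<close>

fun doteq_var :: "params \<Rightarrow> var \<Rightarrow> bool list \<Rightarrow> var \<Rightarrow> fmd3" where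
  "doteq_var \<Delta> u [] v = sim_eq \<Delta> u v"
| "doteq_var \<Delta> u [k] v = sim_sub \<Delta> (proj \<Delta> k) u v"
| "doteq_var \<Delta> u (k # l # i) v =
     (let w = third u v in
      Ex w (doteq_var \<Delta> u (butlast (k # l # i)) w \<^bold>\<and>
            sim_sub \<Delta> (proj \<Delta> (last (k # l # i))) w v))"

text \<open>The formula \<open>u\<^sub>i \<doteq> v\<^sub>j\<close> for distinct \<open>u, v\<close>.\<close>

definition doteq_dist :: "params \<Rightarrow> var \<Rightarrow> bool list \<Rightarrow> var \<Rightarrow> bool list \<Rightarrow> fmd3" where
  "doteq_dist \<Delta> u i v j =
     (if j = [] then doteq_var \<Delta> u i v
      else let w = third u v in Ex w (doteq_var \<Delta> u i w \<^bold>\<and> doteq_var \<Delta> v j w))"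

definition doteq :: "params \<Rightarrow> var \<Rightarrow> bool list \<Rightarrow> var \<Rightarrow> bool list \<Rightarrow> fmd3" where
  "doteq \<Delta> u i v j =
     (if u \<noteq> v then doteq_dist \<Delta> u i v j
      else case u of
        VX \<Rightarrow> Ex VY (sim_eq \<Delta> VX VY \<^bold>\<and> doteq_dist \<Delta> VX i VY j)
      | VY \<Rightarrow> Ex VX (sim_eq \<Delta> VX VY \<^bold>\<and> doteq_dist \<Delta> VX i VY j)
      | VZ \<Rightarrow> Ex VX (doteq_dist \<Delta> VZ i VX [] \<^bold>\<and> doteq_dist \<Delta> VZ j VX []))"


section \<open>The axiom Ax\<close>

definition vars :: "var list" where
  "vars = [VX, VY, VZ]"

definition H :: "bool list list" where
  "H = concat (map (\<lambda>n. List.n_lists n [False, True]) [0..<4])"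

lemma set_vars: "set vars = UNIV"
  using var.exhaust by (auto simp: vars_def)

lemma set_H: "set H = {i. length i \<le> 3}"
  by (auto simp: H_def set_n_lists)

definition ax_A1 :: "params \<Rightarrow> fmd3 list" where
  "ax_A1 \<Delta> =
     [doteq \<Delta> u i v j \<^bold>\<and> doteq \<Delta> v j w k \<^bold>\<longrightarrow> doteq \<Delta> u i w k.
        u \<leftarrow> vars, v \<leftarrow> vars, w \<leftarrow> vars, i \<leftarrow> H, j \<leftarrow> H, k \<leftarrow> H]"

definition ax_A2 :: "params \<Rightarrow> fmd3 list" where
  "ax_A2 \<Delta> =
     [doteq \<Delta> u i v j \<^bold>\<and> doteq \<Delta> u (i @ [k]) u (i @ [k]) \<^bold>\<longrightarrow> doteq \<Delta> u (i @ [k]) v (j @ [k]).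
        u \<leftarrow> vars, v \<leftarrow> vars, k \<leftarrow> [False, True], i \<leftarrow> H, j \<leftarrow> H,
        i @ [k] \<in> set H \<and> j @ [k] \<in> set H]"

definition ax_A3 :: "params \<Rightarrow> fmd3 list" where
  "ax_A3 \<Delta> =
     [doteq \<Delta> u i u i \<^bold>\<and> doteq \<Delta> v j v j \<^bold>\<longrightarrow>
        Ex w (doteq \<Delta> w [False] u i \<^bold>\<and> doteq \<Delta> w [True] v j).
        u \<leftarrow> vars, v \<leftarrow> vars, w \<leftarrow> vars, w \<notin> {u, v}, i \<leftarrow> H, j \<leftarrow> H]"

definition ax_A4 :: "params \<Rightarrow> fmd3 list" where
  "ax_A4 \<Delta> = [Ex w (doteq \<Delta> u [] w []). u \<leftarrow> vars, w \<leftarrow> vars]"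

fun Conj :: "fmd3 list \<Rightarrow> fmd3" where
  "Conj [] = Atm \<^bold>\<or> \<^bold>\<not> Atm"
| "Conj [\<phi>] = \<phi>"
| "Conj (\<phi> # \<psi> # \<chi>s) = \<phi> \<^bold>\<and> Conj (\<psi> # \<chi>s)"

definition Ax :: "params \<Rightarrow> fmd3" where
  "Ax \<Delta> = Conj (ax_A1 \<Delta> @ ax_A2 \<Delta> @ ax_A3 \<Delta> @ ax_A4 \<Delta>)"


section \<open>The relation-algebraic operations on formulas\<close>

definition pair_fm :: "params \<Rightarrow> fmd3" where
  "pair_fm \<Delta> = Ex VY (proj0 \<Delta>) \<^bold>\<and> Ex VY (proj1 \<Delta>)"

text \<open>The formula \<open>\<phi>u\<^sub>i\<close>, for \<open>u\<close> among \<open>y, z\<close>.\<close>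

definition at_term :: "params \<Rightarrow> fmd3 \<Rightarrow> var \<Rightarrow> bool list \<Rightarrow> fmd3" where
  "at_term \<Delta> \<phi> u i = Ex VX (doteq \<Delta> VX [] u i \<^bold>\<and> \<phi>)"

definition comp_fm :: "params \<Rightarrow> fmd3 \<Rightarrow> fmd3 \<Rightarrow> fmd3" where
  "comp_fm \<Delta> \<phi> \<psi> =
     Ex VY (at_term \<Delta> \<phi> VY [False] \<^bold>\<and> at_term \<Delta> \<psi> VY [True] \<^bold>\<and>
            doteq \<Delta> VX [False] VY [False, False] \<^bold>\<and>
            doteq \<Delta> VY [False, True] VY [True, False] \<^bold>\<and>
            doteq \<Delta> VY [True, True] VX [True])"

definition conv_fm :: "params \<Rightarrow> fmd3 \<Rightarrow> fmd3" where
  "conv_fm \<Delta> \<phi> =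
     Ex VY (at_term \<Delta> \<phi> VY [] \<^bold>\<and> doteq \<Delta> VY [False] VX [True] \<^bold>\<and>
            doteq \<Delta> VY [True] VX [False])"

definition id_fm :: "params \<Rightarrow> fmd3" where
  "id_fm \<Delta> = doteq \<Delta> VX [False] VX [True]"

definition compl_fm :: "params \<Rightarrow> fmd3 \<Rightarrow> fmd3" where
  "compl_fm \<Delta> \<phi> = pair_fm \<Delta> \<^bold>\<and> \<^bold>\<not> \<phi>"

definition plus_fm :: "fmd3 \<Rightarrow> fmd3 \<Rightarrow> fmd3" where
  "plus_fm \<phi> \<psi> = \<phi> \<^bold>\<or> \<psi>"

definition Dra :: "params \<Rightarrow> fmd3 set" where
  "Dra \<Delta> = {\<phi>. \<exists>\<psi>\<in>Fmd1. {Ax \<Delta>} \<turnstile> \<phi> \<^bold>\<longleftrightarrow> comp_fm \<Delta> \<psi> (id_fm \<Delta>)}"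


section \<open>Relation algebras and quotients\<close>

record 'a ra =
  carr :: "'a set"
  join :: "'a \<Rightarrow> 'a \<Rightarrow> 'a"  (infixl "\<squnion>\<index>" 65)
  cmpl :: "'a \<Rightarrow> 'a"  ("\<ominus>\<index> _" [81] 80)
  rcomp :: "'a \<Rightarrow> 'a \<Rightarrow> 'a"  (infixl "\<Zsemi>\<index>" 70)
  conv :: "'a \<Rightarrow> 'a"  ("_ \<smile>\<index>" [90] 90)
  ident :: "'a"  ("\<one>\<index>")

definition meet :: "('a, 'b) ra_scheme \<Rightarrow> 'a \<Rightarrow> 'a \<Rightarrow> 'a"  (infixl "\<sqinter>\<index>" 70) where
  "a \<sqinter>\<^bsub>A\<^esub> b = \<ominus>\<^bsub>A\<^esub> (\<ominus>\<^bsub>A\<^esub> a \<squnion>\<^bsub>A\<^esub> \<ominus>\<^bsub>A\<^esub> b)"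

definition ra_le :: "('a, 'b) ra_scheme \<Rightarrow> 'a \<Rightarrow> 'a \<Rightarrow> bool"  (infix "\<sqsubseteq>\<index>" 50) where
  "a \<sqsubseteq>\<^bsub>A\<^esub> b \<longleftrightarrow> a \<squnion>\<^bsub>A\<^esub> b = b"

text \<open>Boolean algebras in the signature \<open>+, -\<close>: complemented distributive lattices, the meet being
  the De Morgan dual of the join. The complement laws say that \<open>a + -a\<close> and \<open>a \<cdot> -a\<close> do not
  depend on \<open>a\<close>; by absorption they are the greatest and the least element.\<close>

locale boolean_reduct =
  fixes A :: "('a, 'b) ra_scheme" (structure)
  assumes join_closed: "\<lbrakk>a \<in> carr A; b \<in> carr A\<rbrakk> \<Longrightarrow> a \<squnion> b \<in> carr A"
    and cmpl_closed: "a \<in> carr A \<Longrightarrow> \<ominus> a \<in> carr A"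
    and join_assoc: "\<lbrakk>a \<in> carr A; b \<in> carr A; c \<in> carr A\<rbrakk> \<Longrightarrow> (a \<squnion> b) \<squnion> c = a \<squnion> (b \<squnion> c)"
    and join_comm: "\<lbrakk>a \<in> carr A; b \<in> carr A\<rbrakk> \<Longrightarrow> a \<squnion> b = b \<squnion> a"
    and meet_assoc: "\<lbrakk>a \<in> carr A; b \<in> carr A; c \<in> carr A\<rbrakk> \<Longrightarrow> (a \<sqinter> b) \<sqinter> c = a \<sqinter> (b \<sqinter> c)"
    and meet_comm: "\<lbrakk>a \<in> carr A; b \<in> carr A\<rbrakk> \<Longrightarrow> a \<sqinter> b = b \<sqinter> a"
    and join_absorb: "\<lbrakk>a \<in> carr A; b \<in> carr A\<rbrakk> \<Longrightarrow> a \<squnion> (a \<sqinter> b) = a"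
    and meet_absorb: "\<lbrakk>a \<in> carr A; b \<in> carr A\<rbrakk> \<Longrightarrow> a \<sqinter> (a \<squnion> b) = a"
    and meet_distrib:
      "\<lbrakk>a \<in> carr A; b \<in> carr A; c \<in> carr A\<rbrakk> \<Longrightarrow> a \<sqinter> (b \<squnion> c) = (a \<sqinter> b) \<squnion> (a \<sqinter> c)"
    and join_cmpl: "\<lbrakk>a \<in> carr A; b \<in> carr A\<rbrakk> \<Longrightarrow> a \<squnion> \<ominus> a = b \<squnion> \<ominus> b"
    and meet_cmpl: "\<lbrakk>a \<in> carr A; b \<in> carr A\<rbrakk> \<Longrightarrow> a \<sqinter> \<ominus> a = b \<sqinter> \<ominus> b"

locale relation_algebra = boolean_reduct +
  assumes rcomp_closed: "\<lbrakk>a \<in> carr A; b \<in> carr A\<rbrakk> \<Longrightarrow> a \<Zsemi> b \<in> carr A"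
    and conv_closed: "a \<in> carr A \<Longrightarrow> a \<smile> \<in> carr A"
    and ident_closed: "\<one> \<in> carr A"
    and rcomp_assoc: "\<lbrakk>a \<in> carr A; b \<in> carr A; c \<in> carr A\<rbrakk> \<Longrightarrow> (a \<Zsemi> b) \<Zsemi> c = a \<Zsemi> (b \<Zsemi> c)"
    and rcomp_distrib:
      "\<lbrakk>a \<in> carr A; b \<in> carr A; c \<in> carr A\<rbrakk> \<Longrightarrow> (a \<squnion> b) \<Zsemi> c = (a \<Zsemi> c) \<squnion> (b \<Zsemi> c)"
    and rcomp_ident: "a \<in> carr A \<Longrightarrow> a \<Zsemi> \<one> = a"
    and conv_conv: "a \<in> carr A \<Longrightarrow> (a \<smile>) \<smile> = a"
    and conv_join: "\<lbrakk>a \<in> carr A; b \<in> carr A\<rbrakk> \<Longrightarrow> (a \<squnion> b) \<smile> = (a \<smile>) \<squnion> (b \<smile>)"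
    and conv_rcomp: "\<lbrakk>a \<in> carr A; b \<in> carr A\<rbrakk> \<Longrightarrow> (a \<Zsemi> b) \<smile> = (b \<smile>) \<Zsemi> (a \<smile>)"
    and tarski: "\<lbrakk>a \<in> carr A; b \<in> carr A\<rbrakk> \<Longrightarrow> (a \<smile>) \<Zsemi> (\<ominus> (a \<Zsemi> b)) \<sqsubseteq> \<ominus> b"

definition quasi_projection_pair :: "('a, 'b) ra_scheme \<Rightarrow> 'a \<Rightarrow> 'a \<Rightarrow> bool" where
  "quasi_projection_pair A p q \<longleftrightarrow>
     p \<in> carr A \<and> q \<in> carr A \<and>
     (((p \<smile>\<^bsub>A\<^esub>) \<Zsemi>\<^bsub>A\<^esub> p) \<squnion>\<^bsub>A\<^esub> ((q \<smile>\<^bsub>A\<^esub>) \<Zsemi>\<^bsub>A\<^esub> q)) \<sqsubseteq>\<^bsub>A\<^esub> \<one>\<^bsub>A\<^esub> \<and>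
     (p \<smile>\<^bsub>A\<^esub>) \<Zsemi>\<^bsub>A\<^esub> q = \<one>\<^bsub>A\<^esub> \<squnion>\<^bsub>A\<^esub> (\<ominus>\<^bsub>A\<^esub> \<one>\<^bsub>A\<^esub>)"

definition ra_congruence :: "('a, 'b) ra_scheme \<Rightarrow> ('a \<times> 'a) set \<Rightarrow> bool" where
  "ra_congruence A R \<longleftrightarrow>
     equiv (carr A) R \<and>
     (\<forall>(a, a') \<in> R. \<forall>(b, b') \<in> R. (a \<squnion>\<^bsub>A\<^esub> b, a' \<squnion>\<^bsub>A\<^esub> b') \<in> R) \<and>
     (\<forall>(a, a') \<in> R. (\<ominus>\<^bsub>A\<^esub> a, \<ominus>\<^bsub>A\<^esub> a') \<in> R) \<and>
     (\<forall>(a, a') \<in> R. \<forall>(b, b') \<in> R. (a \<Zsemi>\<^bsub>A\<^esub> b, a' \<Zsemi>\<^bsub>A\<^esub> b') \<in> R) \<and>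
     (\<forall>(a, a') \<in> R. (a \<smile>\<^bsub>A\<^esub>, a' \<smile>\<^bsub>A\<^esub>) \<in> R)"

text \<open>An operation applied to classes is the union of the classes of all results on
  representatives; this is a single class when \<open>R\<close> is a congruence.\<close>

definition ra_quotient :: "'a ra \<Rightarrow> ('a \<times> 'a) set \<Rightarrow> 'a set ra" where
  "ra_quotient A R =
     \<lparr>carr = carr A // R,
      join = (\<lambda>S T. \<Union>a\<in>S. \<Union>b\<in>T. R `` {a \<squnion>\<^bsub>A\<^esub> b}),
      cmpl = (\<lambda>S. \<Union>a\<in>S. R `` {\<ominus>\<^bsub>A\<^esub> a}),
      rcomp = (\<lambda>S T. \<Union>a\<in>S. \<Union>b\<in>T. R `` {a \<Zsemi>\<^bsub>A\<^esub> b}),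
      conv = (\<lambda>S. \<Union>a\<in>S. R `` {a \<smile>\<^bsub>A\<^esub>}),
      ident = R `` {\<one>\<^bsub>A\<^esub>}\<rparr>"

definition Dra_alg :: "params \<Rightarrow> fmd3 ra" where
  "Dra_alg \<Delta> =
     \<lparr>carr = Dra \<Delta>, join = plus_fm, cmpl = compl_fm \<Delta>, rcomp = comp_fm \<Delta>,
      conv = conv_fm \<Delta>, ident = id_fm \<Delta>\<rparr>"

definition Dra_eq :: "params \<Rightarrow> (fmd3 \<times> fmd3) set" where
  "Dra_eq \<Delta> = Restr (prov_eq {Ax \<Delta>}) (Dra \<Delta>)"

end

theory Submission
  imports Defs
begin

text \<open>The proof calculus axiomatises three commuting S5 modalities, so provability from \<open>Ax\<close> is truth
  in all worlds of a canonical model: ultrafilters of the Lindenbaum algebra, with one equivalence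
  relation between worlds for each variable, any two of these commuting. Moving along the relation of
  \<open>v\<close> means giving \<open>v\<close> a new value. What is lost compared with first-order logic is that a relation
  between two variables cannot be renamed with the help of the third one. Predicates of a single
  variable can be moved freely, however, and pairing allows a finite configuration of elements to be
  packed into one variable. A relation is therefore represented by a predicate of pairs, and each
  relation algebra law is checked by first packing all elements involved into one variable, which
  frees the other two for witnesses. Indices of length at most 3 suffice for this. The set \<open>D\<^sub>r\<^sub>a\<close>
  consists of the formulas whose truth depends only on the two components of \<open>x\<close>.\<close>

section \<open>The canonical model\<close>

text \<open>Nothing makes the projections total: \<open>eqt w u i u i\<close> is not a truism but
  says that the term \<open>u_i\<close> has a value, and each law must keep track of which terms are
  defined. Simulated equality is a congruence for the projections only. An arbitrary formula of
  \<open>x\<close> may separate equal elements, and no axiom makes a pair unique; hence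
  \<open>At\<close> saturates under equality and \<open>extensional\<close> has to be demanded.

  One manoeuvre recurs. An auxiliary variable is changed, something is derived in the new world, and
  the result, when it does not mention that variable, is carried back by invariance. If two
  variables have been changed and only the second change is wanted, commutation of the two relations
  yields a world in which the second change alone was made. This is how a witness is moved from one
  variable to another.

  The index length 3 is reached in associativity and in Tarski's law: the witness of a composition
  is a pair of pairs, and packing it with one more variable adds one index.\<close>

locale kripke =
  fixes W :: "'w set"
    and ag :: "var \<Rightarrow> 'w \<Rightarrow> 'w \<Rightarrow> bool"
    and sat :: "'w \<Rightarrow> fmd3 \<Rightarrow> bool"  (infix "\<Turnstile>" 45)
  assumes ag_in: "ag v w w' \<Longrightarrow> w \<in> W \<and> w' \<in> W"
    and ag_refl: "w \<in> W \<Longrightarrow> ag v w w"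
    and ag_sym: "ag v w w' \<Longrightarrow> ag v w' w"
    and ag_trans: "ag v w w' \<Longrightarrow> ag v w' w'' \<Longrightarrow> ag v w w''"
    and ag_commute: "ag u w w1 \<Longrightarrow> ag v w1 w2 \<Longrightarrow> \<exists>w1'. ag v w w1' \<and> ag u w1' w2"
    and sat_Or: "w \<in> W \<Longrightarrow> w \<Turnstile> \<phi> \<^bold>\<or> \<psi> \<longleftrightarrow> w \<Turnstile> \<phi> \<or> w \<Turnstile> \<psi>"
    and sat_Neg: "w \<in> W \<Longrightarrow> w \<Turnstile> \<^bold>\<not> \<phi> \<longleftrightarrow> \<not> w \<Turnstile> \<phi>"
    and sat_Ex: "w \<in> W \<Longrightarrow> w \<Turnstile> Ex v \<phi> \<longleftrightarrow> (\<exists>w'. ag v w w' \<and> w' \<Turnstile> \<phi>)"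

section \<open>Derived rules of the calculus\<close>

lemma prop_eval_simps [simp]:
  "prop_eval h (\<phi> \<^bold>\<and> \<psi>) \<longleftrightarrow> prop_eval h \<phi> \<and> prop_eval h \<psi>"
  "prop_eval h (\<phi> \<^bold>\<longrightarrow> \<psi>) \<longleftrightarrow> (prop_eval h \<phi> \<longrightarrow> prop_eval h \<psi>)"
  "prop_eval h (\<phi> \<^bold>\<longleftrightarrow> \<psi>) \<longleftrightarrow> (prop_eval h \<phi> \<longleftrightarrow> prop_eval h \<psi>)"
  "prop_eval h (All v \<phi>) \<longleftrightarrow> \<not> h (Ex v (\<^bold>\<not> \<phi>))"
  by (auto simp: And_def Imp_def Iff_def All_def)

lemma prov_taut: "(\<And>h. prop_eval h \<phi>) \<Longrightarrow> T \<turnstile> \<phi>"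
  by (simp add: ax1 tautology_def)

lemma prov_cons:
  "T \<turnstile> \<phi> \<Longrightarrow> (\<And>h. prop_eval h \<phi> \<Longrightarrow> prop_eval h \<psi>) \<Longrightarrow> T \<turnstile> \<psi>"
  by (rule mp[of T \<phi>], assumption, rule prov_taut, simp)

lemma prov_cons2:
  "T \<turnstile> \<phi> \<Longrightarrow> T \<turnstile> \<psi> \<Longrightarrow> (\<And>h. prop_eval h \<phi> \<Longrightarrow> prop_eval h \<psi> \<Longrightarrow> prop_eval h \<chi>) \<Longrightarrow> T \<turnstile> \<chi>"
  by (rule mp[of T \<psi>], assumption, rule prov_cons[of T \<phi>]) auto

lemma prov_Ex_mono: "T \<turnstile> \<phi> \<^bold>\<longrightarrow> \<psi> \<Longrightarrow> T \<turnstile> Ex v \<phi> \<^bold>\<longrightarrow> Ex v \<psi>"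
  using ax2 gen mp by blast

lemma prov_All_mono: "T \<turnstile> \<phi> \<^bold>\<longrightarrow> \<psi> \<Longrightarrow> T \<turnstile> All v \<phi> \<^bold>\<longrightarrow> All v \<psi>"
  by (rule prov_cons[OF prov_Ex_mono[of T "\<^bold>\<not> \<psi>" "\<^bold>\<not> \<phi>" v]], erule prov_cons) auto

lemma prov_All_mp: "T \<turnstile> All v \<phi> \<^bold>\<longrightarrow> All v (\<phi> \<^bold>\<longrightarrow> \<psi>) \<^bold>\<longrightarrow> All v \<psi>"
proof -
  have "T \<turnstile> Ex v (\<^bold>\<not> \<psi>) \<^bold>\<longrightarrow> Ex v (\<^bold>\<not> \<phi> \<^bold>\<or> \<^bold>\<not> (\<phi> \<^bold>\<longrightarrow> \<psi>))"
    by (rule prov_Ex_mono, rule prov_taut) auto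
  then show ?thesis
    by (rule prov_cons2[OF _ ax5[of T v "\<^bold>\<not> \<phi>" "\<^bold>\<not> (\<phi> \<^bold>\<longrightarrow> \<psi>)"]]) auto
qed

text \<open>Filters of the Lindenbaum algebra, as sets of formulas; the worlds are the ultrafilters.\<close>

definition is_filter :: "fmd3 set \<Rightarrow> fmd3 set \<Rightarrow> bool" where
  "is_filter T F \<longleftrightarrow> (\<forall>\<phi>. T \<turnstile> \<phi> \<longrightarrow> \<phi> \<in> F) \<and> (\<forall>\<phi> \<psi>. \<phi> \<in> F \<longrightarrow> \<phi> \<^bold>\<longrightarrow> \<psi> \<in> F \<longrightarrow> \<psi> \<in> F)"

definition worlds :: "fmd3 set \<Rightarrow> fmd3 set set" where
  "worlds T = {G. is_filter T G \<and> (\<forall>\<phi>. \<^bold>\<not> \<phi> \<in> G \<longleftrightarrow> \<phi> \<notin> G)}"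

definition agree :: "fmd3 set \<Rightarrow> var \<Rightarrow> fmd3 set \<Rightarrow> fmd3 set \<Rightarrow> bool" where
  "agree T v G G' \<longleftrightarrow> G \<in> worlds T \<and> G' \<in> worlds T \<and> (\<forall>\<phi>\<in>G'. Ex v \<phi> \<in> G)"

lemma filter_prov: "is_filter T F \<Longrightarrow> T \<turnstile> \<phi> \<Longrightarrow> \<phi> \<in> F"
  by (simp add: is_filter_def)

lemma filter_mp: "is_filter T F \<Longrightarrow> T \<turnstile> \<phi> \<^bold>\<longrightarrow> \<psi> \<Longrightarrow> \<phi> \<in> F \<Longrightarrow> \<psi> \<in> F"
  unfolding is_filter_def by blast

lemma filter_mp2: "is_filter T F \<Longrightarrow> T \<turnstile> \<phi> \<^bold>\<longrightarrow> \<psi> \<^bold>\<longrightarrow> \<chi> \<Longrightarrow> \<phi> \<in> F \<Longrightarrow> \<psi> \<in> F \<Longrightarrow> \<chi> \<in> F"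
  unfolding is_filter_def by blast

text \<open>Filters are closed under modus ponens but not under generalization, so adjoining
  \<open>\<psi>\<close> amounts to using it as a premise of an implication.\<close>

lemma filter_adjoin:
  assumes "is_filter T G"
  shows "is_filter T {\<chi>. \<psi> \<^bold>\<longrightarrow> \<chi> \<in> G}" and "G \<subseteq> {\<chi>. \<psi> \<^bold>\<longrightarrow> \<chi> \<in> G}"
proof -
  have "\<psi> \<^bold>\<longrightarrow> \<chi> \<in> G" if "T \<turnstile> \<chi>" for \<chi>
    by (rule filter_prov[OF assms], rule prov_cons[OF that]) simp
  moreover have "\<psi> \<^bold>\<longrightarrow> \<xi> \<in> G" if "\<psi> \<^bold>\<longrightarrow> \<chi> \<in> G" "\<psi> \<^bold>\<longrightarrow> \<chi> \<^bold>\<longrightarrow> \<xi> \<in> G" for \<chi> \<xi>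
    by (rule filter_mp2[OF assms _ that], rule prov_taut) auto
  ultimately show "is_filter T {\<chi>. \<psi> \<^bold>\<longrightarrow> \<chi> \<in> G}"
    unfolding is_filter_def by blast
  show "G \<subseteq> {\<chi>. \<psi> \<^bold>\<longrightarrow> \<chi> \<in> G}"
    using filter_mp[OF assms prov_taut[of "\<chi> \<^bold>\<longrightarrow> \<psi> \<^bold>\<longrightarrow> \<chi>" for \<chi>]] by auto
qed

text \<open>Zorn's lemma gives a filter maximal among those omitting \<open>\<phi>\<close>. It is
  already an ultrafilter: if both \<open>\<psi>\<close> and its negation were missing, adjoining
  either would produce \<open>\<phi>\<close>, and a case distinction inside the filter would then
  put \<open>\<phi>\<close> into it.\<close>

lemma world_extends_filter:
  assumes F: "is_filter T F" and \<phi>: "\<phi> \<notin> F"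
  obtains G where "G \<in> worlds T" "F \<subseteq> G" "\<phi> \<notin> G"
proof -
  let ?A = "{G. is_filter T G \<and> F \<subseteq> G \<and> \<phi> \<notin> G}"
  have "\<exists>G\<in>?A. \<forall>G'\<in>?A. G \<subseteq> G' \<longrightarrow> G' = G"
  proof (rule subset_Zorn_nonempty)
    show "?A \<noteq> {}" using F \<phi> by blast
  next
    fix C assume C: "C \<noteq> {}" "subset.chain ?A C"
    have sub: "C \<subseteq> ?A" using C by (auto simp: subset.chain_def)
    have "is_filter T (\<Union>C)"
      unfolding is_filter_def
    proof (intro conjI allI impI)
      fix \<psi> assume "T \<turnstile> \<psi>"
      then show "\<psi> \<in> \<Union>C" using C(1) sub by (auto dest: filter_prov)
    next
      fix \<psi> \<chi> assume "\<psi> \<in> \<Union>C" "\<psi> \<^bold>\<longrightarrow> \<chi> \<in> \<Union>C"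
      then obtain X Y where XY: "X \<in> C" "Y \<in> C" "\<psi> \<in> X" "\<psi> \<^bold>\<longrightarrow> \<chi> \<in> Y" by blast
      then have "X \<subseteq> Y \<or> Y \<subseteq> X" using C(2) by (auto simp: subset.chain_def)
      then obtain Z where "Z \<in> C" "\<psi> \<in> Z" "\<psi> \<^bold>\<longrightarrow> \<chi> \<in> Z" using XY by blast
      moreover have "is_filter T Z" using \<open>Z \<in> C\<close> sub by blast
      ultimately have "\<chi> \<in> Z" unfolding is_filter_def by blast
      then show "\<chi> \<in> \<Union>C" using \<open>Z \<in> C\<close> by blast
    qed
    then show "\<Union>C \<in> ?A" using C(1) sub by blast
  qed
  then obtain G where "G \<in> ?A" and max': "\<forall>G'\<in>?A. G \<subseteq> G' \<longrightarrow> G' = G" by blast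
  then have G: "is_filter T G" "F \<subseteq> G" "\<phi> \<notin> G" by auto
  have max: "G' = G" if "is_filter T G'" "G \<subseteq> G'" "\<phi> \<notin> G'" for G'
    using max' that G(2) by (metis (mono_tags, lifting) mem_Collect_eq subset_trans)
  have in_or: "\<psi> \<in> G" if "\<psi> \<^bold>\<longrightarrow> \<phi> \<notin> G" for \<psi>
  proof -
    have "{\<chi>. \<psi> \<^bold>\<longrightarrow> \<chi> \<in> G} = G"
      using filter_adjoin[OF G(1), of \<psi>] that by (intro max) auto
    moreover have "\<psi> \<^bold>\<longrightarrow> \<psi> \<in> G" by (rule filter_prov[OF G(1) prov_taut]) auto
    ultimately show ?thesis by blast
  qed
  have "\<^bold>\<not> \<psi> \<in> G \<longleftrightarrow> \<psi> \<notin> G" for \<psi>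
  proof
    assume "\<^bold>\<not> \<psi> \<in> G"
    then show "\<psi> \<notin> G"
      using filter_mp2[OF G(1), of "\<^bold>\<not> \<psi>" \<psi> \<phi>] G(3) prov_taut[of "\<^bold>\<not> \<psi> \<^bold>\<longrightarrow> \<psi> \<^bold>\<longrightarrow> \<phi>" T] by auto
  next
    assume "\<psi> \<notin> G"
    then have 1: "\<psi> \<^bold>\<longrightarrow> \<phi> \<in> G" using in_or by blast
    have "\<^bold>\<not> \<psi> \<^bold>\<longrightarrow> \<phi> \<notin> G"
    proof
      assume 2: "\<^bold>\<not> \<psi> \<^bold>\<longrightarrow> \<phi> \<in> G"
      have "\<phi> \<in> G" by (rule filter_mp2[OF G(1) _ 1 2], rule prov_taut) auto
      with G(3) show False by blast
    qed
    then show "\<^bold>\<not> \<psi> \<in> G" by (rule in_or)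
  qed
  then show ?thesis using G that by (auto simp: worlds_def)
qed

text \<open>The theorems of \<open>T\<close> themselves form a filter, and a non-theorem is omitted
  by some world extending it.\<close>

lemma prov_iff_worlds: "T \<turnstile> \<phi> \<longleftrightarrow> (\<forall>G\<in>worlds T. \<phi> \<in> G)"
proof
  assume "T \<turnstile> \<phi>"
  then show "\<forall>G\<in>worlds T. \<phi> \<in> G" by (auto simp: worlds_def dest: filter_prov)
next
  assume *: "\<forall>G\<in>worlds T. \<phi> \<in> G"
  have "is_filter T {\<psi>. T \<turnstile> \<psi>}" unfolding is_filter_def using mp by blast
  then show "T \<turnstile> \<phi>" using world_extends_filter[of T "{\<psi>. T \<turnstile> \<psi>}" \<phi>] * by blast
qed

lemma world_filter: "G \<in> worlds T \<Longrightarrow> is_filter T G"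
  by (simp add: worlds_def)

lemma world_Neg: "G \<in> worlds T \<Longrightarrow> \<^bold>\<not> \<phi> \<in> G \<longleftrightarrow> \<phi> \<notin> G"
  by (simp add: worlds_def)

lemma agreeI:
  assumes "G \<in> worlds T" "G' \<in> worlds T" "\<And>\<chi>. All v \<chi> \<in> G \<Longrightarrow> \<chi> \<in> G'"
  shows "agree T v G G'"
  unfolding agree_def
proof (intro conjI ballI)
  fix \<chi> assume "\<chi> \<in> G'"
  then have "All v (\<^bold>\<not> \<chi>) \<notin> G" using assms world_Neg by blast
  then have "Ex v (\<^bold>\<not> \<^bold>\<not> \<chi>) \<in> G" using assms(1) by (simp add: All_def world_Neg)
  then show "Ex v \<chi> \<in> G"
    by (rule filter_mp[OF world_filter[OF assms(1)], rotated]) (intro prov_Ex_mono prov_taut, simp)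
qed (use assms in auto)

lemma agree_witness:
  assumes G: "G \<in> worlds T" and ex: "Ex v \<phi> \<in> G"
  shows "\<exists>G'. agree T v G G' \<and> \<phi> \<in> G'"
proof -
  note f = world_filter[OF G]
  \<comment> \<open>The filter generated by \<open>\<phi>\<close> and by all \<open>\<chi>\<close>
    with \<open>All v \<chi>\<close> in \<open>G\<close>, which is what the new world must
    contain.\<close>
  let ?F = "{\<chi>. All v (\<phi> \<^bold>\<longrightarrow> \<chi>) \<in> G}"
  have "is_filter T ?F"
    unfolding is_filter_def
  proof (intro conjI allI impI CollectI)
    fix \<chi> assume "T \<turnstile> \<chi>"
    then show "All v (\<phi> \<^bold>\<longrightarrow> \<chi>) \<in> G"
      by (intro filter_prov[OF f] gen) (erule prov_cons, simp)
  next
    fix \<chi> \<xi> assume "\<chi> \<in> ?F" "\<chi> \<^bold>\<longrightarrow> \<xi> \<in> ?F"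
    then have 1: "All v (\<phi> \<^bold>\<longrightarrow> \<chi>) \<in> G" and 2: "All v (\<phi> \<^bold>\<longrightarrow> \<chi> \<^bold>\<longrightarrow> \<xi>) \<in> G" by auto
    have "T \<turnstile> All v (\<phi> \<^bold>\<longrightarrow> \<chi> \<^bold>\<longrightarrow> \<xi>) \<^bold>\<longrightarrow> All v ((\<phi> \<^bold>\<longrightarrow> \<chi>) \<^bold>\<longrightarrow> (\<phi> \<^bold>\<longrightarrow> \<xi>))"
      by (rule prov_All_mono, rule prov_taut) auto
    then have "All v ((\<phi> \<^bold>\<longrightarrow> \<chi>) \<^bold>\<longrightarrow> (\<phi> \<^bold>\<longrightarrow> \<xi>)) \<in> G" using filter_mp[OF f] 2 by blast
    then show "All v (\<phi> \<^bold>\<longrightarrow> \<xi>) \<in> G" using filter_mp2[OF f prov_All_mp] 1 by blast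
  qed
  moreover have "\<^bold>\<not> \<phi> \<notin> ?F"
  proof
    assume "\<^bold>\<not> \<phi> \<in> ?F"
    moreover have "T \<turnstile> Ex v \<phi> \<^bold>\<longrightarrow> Ex v (\<^bold>\<not> (\<phi> \<^bold>\<longrightarrow> \<^bold>\<not> \<phi>))"
      by (rule prov_Ex_mono, rule prov_taut) auto
    ultimately show False using ex filter_mp[OF f] world_Neg[OF G] by (auto simp: All_def)
  qed
  ultimately obtain G' where G': "G' \<in> worlds T" "?F \<subseteq> G'" "\<^bold>\<not> \<phi> \<notin> G'"
    by (rule world_extends_filter)
  have "agree T v G G'"
  proof (rule agreeI[OF G G'(1)])
    fix \<chi> assume "All v \<chi> \<in> G"
    then have "All v (\<phi> \<^bold>\<longrightarrow> \<chi>) \<in> G"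
      by (rule filter_mp[OF f, rotated]) (intro prov_All_mono prov_taut, simp)
    then show "\<chi> \<in> G'" using G' by blast
  qed
  then show ?thesis using G' world_Neg by blast
qed

lemma agree_commute:
  assumes "agree T u G G1" "agree T v G1 G2"
  shows "\<exists>G'. agree T v G G' \<and> agree T u G' G2"
proof -
  have G: "G \<in> worlds T" and G2: "G2 \<in> worlds T" using assms by (auto simp: agree_def)
  note f = world_filter[OF G] and f2 = world_filter[OF G2]
  let ?F = "{\<chi>. \<exists>\<psi>\<in>G2. All v (Ex u \<psi> \<^bold>\<longrightarrow> \<chi>) \<in> G}"
  have "is_filter T ?F"
    unfolding is_filter_def
  proof (intro conjI allI impI CollectI)
    fix \<chi> assume "T \<turnstile> \<chi>"
    then have "T \<turnstile> Ex u \<chi> \<^bold>\<longrightarrow> \<chi>" by (rule prov_cons) simp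
    then show "\<exists>\<psi>\<in>G2. All v (Ex u \<psi> \<^bold>\<longrightarrow> \<chi>) \<in> G"
      using filter_prov[OF f gen] filter_prov[OF f2 \<open>T \<turnstile> \<chi>\<close>] by blast
  next
    fix \<chi> \<xi> assume "\<chi> \<in> ?F" "\<chi> \<^bold>\<longrightarrow> \<xi> \<in> ?F"
    then obtain \<psi>1 \<psi>2 where \<psi>: "\<psi>1 \<in> G2" "\<psi>2 \<in> G2" and 1: "All v (Ex u \<psi>1 \<^bold>\<longrightarrow> \<chi>) \<in> G"
      and 2: "All v (Ex u \<psi>2 \<^bold>\<longrightarrow> \<chi> \<^bold>\<longrightarrow> \<xi>) \<in> G" by auto
    let ?\<psi> = "\<psi>1 \<^bold>\<and> \<psi>2"
    have "T \<turnstile> \<psi>1 \<^bold>\<longrightarrow> \<psi>2 \<^bold>\<longrightarrow> ?\<psi>" by (rule prov_taut) auto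
    then have in2: "?\<psi> \<in> G2" using filter_mp2[OF f2] \<psi> by blast
    have m1: "T \<turnstile> Ex u ?\<psi> \<^bold>\<longrightarrow> Ex u \<psi>1" and m2: "T \<turnstile> Ex u ?\<psi> \<^bold>\<longrightarrow> Ex u \<psi>2"
      by (rule prov_Ex_mono, rule prov_taut, simp)+
    have "T \<turnstile> All v (Ex u \<psi>1 \<^bold>\<longrightarrow> \<chi>) \<^bold>\<longrightarrow> All v (Ex u ?\<psi> \<^bold>\<longrightarrow> \<chi>)"
      by (rule prov_All_mono, rule prov_cons[OF m1]) auto
    then have 1: "All v (Ex u ?\<psi> \<^bold>\<longrightarrow> \<chi>) \<in> G" using filter_mp[OF f] 1 by blast
    have "T \<turnstile> All v (Ex u \<psi>2 \<^bold>\<longrightarrow> \<chi> \<^bold>\<longrightarrow> \<xi>) \<^bold>\<longrightarrow> All v ((Ex u ?\<psi> \<^bold>\<longrightarrow> \<chi>) \<^bold>\<longrightarrow> (Ex u ?\<psi> \<^bold>\<longrightarrow> \<xi>))"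
      by (rule prov_All_mono, rule prov_cons[OF m2]) auto
    then have "All v ((Ex u ?\<psi> \<^bold>\<longrightarrow> \<chi>) \<^bold>\<longrightarrow> (Ex u ?\<psi> \<^bold>\<longrightarrow> \<xi>)) \<in> G" using filter_mp[OF f] 2 by blast
    then have "All v (Ex u ?\<psi> \<^bold>\<longrightarrow> \<xi>) \<in> G" using filter_mp2[OF f prov_All_mp] 1 by blast
    then show "\<exists>\<psi>\<in>G2. All v (Ex u \<psi> \<^bold>\<longrightarrow> \<xi>) \<in> G" using in2 by blast
  qed
  \<comment> \<open>Falsum is not in the filter: the path through \<open>G1\<close> puts
    \<open>Ex u (Ex v \<psi>)\<close> into \<open>G\<close>, and axiom (7) exchanges the two
    quantifiers.\<close>
  moreover have "\<^bold>\<not> (Atm \<^bold>\<longrightarrow> Atm) \<notin> ?F"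
  proof
    assume "\<^bold>\<not> (Atm \<^bold>\<longrightarrow> Atm) \<in> ?F"
    then obtain \<psi> where \<psi>: "\<psi> \<in> G2" "All v (Ex u \<psi> \<^bold>\<longrightarrow> \<^bold>\<not> (Atm \<^bold>\<longrightarrow> Atm)) \<in> G" by blast
    have "Ex u (Ex v \<psi>) \<in> G" using \<psi> assms by (auto simp: agree_def)
    then have "Ex v (Ex u \<psi>) \<in> G" using filter_mp[OF f ax7] by blast
    moreover have "T \<turnstile> Ex v (Ex u \<psi>) \<^bold>\<longrightarrow> Ex v (\<^bold>\<not> (Ex u \<psi> \<^bold>\<longrightarrow> \<^bold>\<not> (Atm \<^bold>\<longrightarrow> Atm)))"
      by (rule prov_Ex_mono, rule prov_taut) auto
    ultimately show False using \<psi>(2) filter_mp[OF f] world_Neg[OF G] by (auto simp: All_def)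
  qed
  ultimately obtain G' where G': "G' \<in> worlds T" "?F \<subseteq> G'"
    by (rule world_extends_filter)
  have "agree T v G G'"
  proof (rule agreeI[OF G G'(1)])
    fix \<chi> assume *: "All v \<chi> \<in> G"
    obtain \<psi> where "\<psi> \<in> G2"
      using filter_prov[OF f2 prov_taut[of "Atm \<^bold>\<longrightarrow> Atm"]] by auto
    moreover have "All v (Ex u \<psi> \<^bold>\<longrightarrow> \<chi>) \<in> G"
      by (rule filter_mp[OF f _ *]) (intro prov_All_mono prov_taut, simp)
    ultimately show "\<chi> \<in> G'" using G' by blast
  qed
  moreover have "Ex u \<psi> \<in> G'" if "\<psi> \<in> G2" for \<psi>
  proof -
    have "All v (Ex u \<psi> \<^bold>\<longrightarrow> Ex u \<psi>) \<in> G"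
      by (intro filter_prov[OF f] gen prov_taut) auto
    then show ?thesis using that G' by blast
  qed
  then have "agree T u G' G2" using G' G2 by (auto simp: agree_def)
  ultimately show ?thesis by blast
qed

text \<open>Each frame condition answers to an axiom: (3) gives reflexivity, (4) transitivity, (6)
  with (3) symmetry, (7) commutation.\<close>

theorem canonical_kripke: "kripke (worlds T) (agree T) (\<lambda>G \<phi>. \<phi> \<in> G)"
proof
  fix v w and G G' G'' G1 G2 :: "fmd3 set" and \<phi> \<psi>
  show "G \<in> worlds T \<and> G' \<in> worlds T" if "agree T v G G'"
    using that by (simp add: agree_def)
  show "agree T v G G" if "G \<in> worlds T"
    using that filter_mp[OF world_filter ax3] by (auto simp: agree_def)
  show "agree T v G' G" if "agree T v G G'"
  proof -
    have W: "G \<in> worlds T" "G' \<in> worlds T" using that by (auto simp: agree_def)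
    have "Ex v \<phi> \<in> G'" if "\<phi> \<in> G" for \<phi>
    proof (rule ccontr)
      assume "Ex v \<phi> \<notin> G'"
      then have "Ex v (\<^bold>\<not> Ex v \<phi>) \<in> G"
        using W \<open>agree T v G G'\<close> by (simp add: agree_def world_Neg)
      then have "Ex v \<phi> \<notin> G"
        using filter_mp[OF world_filter[OF W(1)] ax6] world_Neg[OF W(1)] by blast
      then show False using that filter_mp[OF world_filter[OF W(1)] ax3] by blast
    qed
    then show ?thesis using W by (simp add: agree_def)
  qed
  show "agree T v G G''" if "agree T v G G'" "agree T v G' G''"
    using that filter_mp[OF world_filter ax4] unfolding agree_def by blast
  show "\<exists>G'. agree T w G G' \<and> agree T v G' G2" if "agree T v G G1" "agree T w G1 G2"
    using agree_commute that by blast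
  show "\<^bold>\<not> \<phi> \<in> G \<longleftrightarrow> \<phi> \<notin> G" if "G \<in> worlds T"
    using world_Neg that by blast
  show "\<phi> \<^bold>\<or> \<psi> \<in> G \<longleftrightarrow> \<phi> \<in> G \<or> \<psi> \<in> G" if G: "G \<in> worlds T"
  proof -
    note f = world_filter[OF G]
    have "T \<turnstile> \<phi> \<^bold>\<longrightarrow> \<phi> \<^bold>\<or> \<psi>" "T \<turnstile> \<psi> \<^bold>\<longrightarrow> \<phi> \<^bold>\<or> \<psi>" "T \<turnstile> \<phi> \<^bold>\<or> \<psi> \<^bold>\<longrightarrow> \<^bold>\<not> \<phi> \<^bold>\<longrightarrow> \<psi>"
      by (rule prov_taut, simp)+
    then show ?thesis using filter_mp[OF f] filter_mp2[OF f] world_Neg[OF G] by metis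
  qed
  show "Ex v \<phi> \<in> G \<longleftrightarrow> (\<exists>G'. agree T v G G' \<and> \<phi> \<in> G')" if "G \<in> worlds T"
    using agree_witness[OF that] by (auto simp: agree_def)
qed

section \<open>Free variables of the simulated equations\<close>

lemma fv_simps [simp]:
  "fv (\<phi> \<^bold>\<and> \<psi>) = fv \<phi> \<union> fv \<psi>" "fv (\<phi> \<^bold>\<longrightarrow> \<psi>) = fv \<phi> \<union> fv \<psi>"
  by (auto simp: And_def Imp_def)

lemma third_simps [simp]:
  "third VX VY = VZ" "third VY VX = VZ" "third VX VZ = VY"
  "third VZ VX = VY" "third VY VZ = VX" "third VZ VY = VX"
  by (auto simp: third_def)

text \<open>Also covers \<open>u = v\<close>: below, \<open>third u u\<close> serves as an arbitrary
  auxiliary variable other than \<open>u\<close>.\<close>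

lemma third_neq: "third u v \<noteq> u" "third u v \<noteq> v"
  by (cases u; cases v; simp add: third_def)+

lemma third_commute: "third u v = third v u"
  by (simp add: third_def insert_commute)

locale fv_params =
  fixes \<Delta> :: params
  assumes fv_xy: "fv (delta_xy \<Delta>) \<subseteq> {VX, VY}"
    and fv_xz: "fv (delta_xz \<Delta>) \<subseteq> {VX, VZ}"
    and fv_p0: "fv (proj0 \<Delta>) \<subseteq> {VX, VY}"
    and fv_p1: "fv (proj1 \<Delta>) \<subseteq> {VX, VY}"
begin

lemma fv_sim_eq: "u \<noteq> v \<Longrightarrow> fv (sim_eq \<Delta> u v) \<subseteq> {u, v}"
  using fv_xy fv_xz by (cases u; cases v; auto)

lemma fv_sim_sub: "u \<noteq> v \<Longrightarrow> fv (sim_sub \<Delta> (proj \<Delta> k) u v) \<subseteq> {u, v}"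
  using fv_p0 fv_p1 fv_xy fv_xz by (cases u; cases v; auto simp: proj_def split: if_splits)

lemma fv_doteq_var: "u \<noteq> v \<Longrightarrow> fv (doteq_var \<Delta> u i v) \<subseteq> {u, v}"
proof (induction i arbitrary: v rule: rev_induct)
  case Nil
  then show ?case using fv_sim_eq by simp
next
  case (snoc k i)
  show ?case
  proof (cases i)
    case Nil
    then show ?thesis using snoc fv_sim_sub by simp
  next
    case (Cons l j)
    let ?w = "third u v"
    have eq: "doteq_var \<Delta> u (i @ [k]) v =
        Ex ?w (doteq_var \<Delta> u i ?w \<^bold>\<and> sim_sub \<Delta> (proj \<Delta> k) ?w v)"
      using Cons by (cases j) (simp_all add: Let_def)
    show ?thesis
      unfolding eq using snoc.IH[of ?w] third_neq[of u v] fv_sim_sub[of ?w v k] by auto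
  qed
qed

lemma fv_doteq_dist: "u \<noteq> v \<Longrightarrow> fv (doteq_dist \<Delta> u i v j) \<subseteq> {u, v}"
  using fv_doteq_var[of u v i] fv_doteq_var[of u "third u v" i] fv_doteq_var[of v "third u v" j]
    third_neq[of u v]
  by (auto simp: doteq_dist_def Let_def)

lemma fv_doteq: "fv (doteq \<Delta> u i v j) \<subseteq> {u, v}"
proof (cases "u = v")
  case True
  then show ?thesis
    using fv_sim_eq[of VX VY] fv_doteq_dist[of VX VY i j]
      fv_doteq_dist[of VZ VX i "[]"] fv_doteq_dist[of VZ VX j "[]"]
    by (cases u) (auto simp: doteq_def)
qed (use fv_doteq_dist in \<open>simp add: doteq_def\<close>)

lemma fv_comp_fm: "\<phi> \<in> Fmd1 \<Longrightarrow> \<psi> \<in> Fmd1 \<Longrightarrow> comp_fm \<Delta> \<phi> \<psi> \<in> Fmd1"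
  using fv_doteq[of VX "[]" VY "[False]"] fv_doteq[of VX "[]" VY "[True]"]
    fv_doteq[of VX "[False]" VY "[False, False]"] fv_doteq[of VY "[False, True]" VY "[True, False]"]
    fv_doteq[of VY "[True, True]" VX "[True]"]
  by (auto simp: comp_fm_def Fmd1_def at_term_def)

lemma fv_conv_fm: "\<phi> \<in> Fmd1 \<Longrightarrow> conv_fm \<Delta> \<phi> \<in> Fmd1"
  using fv_doteq[of VX "[]" VY "[]"] fv_doteq[of VY "[False]" VX "[True]"]
    fv_doteq[of VY "[True]" VX "[False]"]
  by (auto simp: conv_fm_def Fmd1_def at_term_def)

lemma fv_doteq_Fmd1: "doteq \<Delta> VX i VX j \<in> Fmd1"
  using fv_doteq[of VX i VX j] by (simp add: Fmd1_def)

lemma fv_compl_fm: "\<phi> \<in> Fmd1 \<Longrightarrow> compl_fm \<Delta> \<phi> \<in> Fmd1"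
  using fv_p0 fv_p1 by (auto simp: compl_fm_def pair_fm_def Fmd1_def)

end

section \<open>Equality of terms in a world\<close>

locale ax_model = kripke W ag sat + fv_params \<Delta>
  for W :: "'w set" and ag and sat :: "'w \<Rightarrow> fmd3 \<Rightarrow> bool"  (infix "\<Turnstile>" 45) and \<Delta> +
  assumes sat_Ax: "w \<in> W \<Longrightarrow> w \<Turnstile> Ax \<Delta>"
begin

lemma sat_And: "w \<in> W \<Longrightarrow> w \<Turnstile> \<phi> \<^bold>\<and> \<psi> \<longleftrightarrow> w \<Turnstile> \<phi> \<and> w \<Turnstile> \<psi>"
  by (simp add: And_def sat_Or sat_Neg)

lemma sat_Imp: "w \<in> W \<Longrightarrow> w \<Turnstile> \<phi> \<^bold>\<longrightarrow> \<psi> \<longleftrightarrow> (w \<Turnstile> \<phi> \<longrightarrow> w \<Turnstile> \<psi>)"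
  by (simp add: Imp_def sat_Or sat_Neg)

lemma sat_Iff: "w \<in> W \<Longrightarrow> w \<Turnstile> (\<phi> \<^bold>\<longleftrightarrow> \<psi>) \<longleftrightarrow> (w \<Turnstile> \<phi> \<longleftrightarrow> w \<Turnstile> \<psi>)"
  by (auto simp: Iff_def sat_And sat_Imp)

lemma sat_Ex_And:
  "w \<in> W \<Longrightarrow> w \<Turnstile> Ex v (\<phi> \<^bold>\<and> \<psi>) \<longleftrightarrow> (\<exists>w'. ag v w w' \<and> w' \<Turnstile> \<phi> \<and> w' \<Turnstile> \<psi>)"
  using ag_in by (auto simp: sat_Ex sat_And)

lemma sat_Conj: "w \<in> W \<Longrightarrow> w \<Turnstile> Conj \<phi>s \<longleftrightarrow> (\<forall>\<phi>\<in>set \<phi>s. w \<Turnstile> \<phi>)"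
  by (induction \<phi>s rule: Conj.induct) (auto simp: sat_And sat_Or sat_Neg)

text \<open>Worlds are not assignments, so this rests on commutation: a witness for
  \<open>Ex u\<close> found from one world is transported along the relation of \<open>v\<close> to
  the other.\<close>

lemma sat_fv: "v \<notin> fv \<phi> \<Longrightarrow> ag v w w' \<Longrightarrow> w \<Turnstile> \<phi> \<longleftrightarrow> w' \<Turnstile> \<phi>"
proof (induction \<phi> arbitrary: w w')
  case Atm
  then show ?case by (cases v) auto
next
  case (Ex u \<phi>)
  have *: "w' \<Turnstile> Ex u \<phi>" if w: "w \<Turnstile> Ex u \<phi>" and a: "ag v w w'" for w w'
  proof -
    obtain w1 where w1: "ag u w w1" "w1 \<Turnstile> \<phi>" using w a ag_in sat_Ex by blast
    show ?thesis
    proof (cases "u = v")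
      case True
      then show ?thesis using w1 a ag_in sat_Ex ag_sym ag_trans by blast
    next
      case False
      then have "v \<notin> fv \<phi>" using Ex.prems by auto
      obtain w2 where "ag u w' w2" "ag v w2 w1" using ag_commute[OF ag_sym[OF a] w1(1)] by blast
      then show ?thesis using Ex.IH[OF \<open>v \<notin> fv \<phi>\<close>] w1 a ag_in sat_Ex by blast
    qed
  qed
  show ?case using *[of w w'] *[of w' w] Ex.prems ag_sym by blast
qed (use ag_in in \<open>auto simp: sat_Or sat_Neg\<close>)

text \<open>The equation \<open>u\<^sub>i \<doteq> v\<^sub>j\<close> in the world \<open>w\<close>; building in the bounds on the indices
  makes it a partial equivalence without side conditions.\<close>

definition eqt :: "'w \<Rightarrow> var \<Rightarrow> bool list \<Rightarrow> var \<Rightarrow> bool list \<Rightarrow> bool" where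
  "eqt w u i v j \<longleftrightarrow> w \<in> W \<and> length i \<le> 3 \<and> length j \<le> 3 \<and> w \<Turnstile> doteq \<Delta> u i v j"

section \<open>The axioms (A1) to (A4) as rules for \<open>eqt\<close>\<close>

lemma sat_axioms:
  assumes "w \<in> W" "\<phi> \<in> set (ax_A1 \<Delta>) \<union> set (ax_A2 \<Delta>) \<union> set (ax_A3 \<Delta>) \<union> set (ax_A4 \<Delta>)"
  shows "w \<Turnstile> \<phi>"
  using assms sat_Ax[OF assms(1)] by (auto simp: Ax_def sat_Conj)

lemma eqt_trans:
  assumes "eqt w u i v j" "eqt w v j t k" shows "eqt w u i t k"
proof -
  have "(doteq \<Delta> u i v j \<^bold>\<and> doteq \<Delta> v j t k \<^bold>\<longrightarrow> doteq \<Delta> u i t k) \<in> set (ax_A1 \<Delta>)"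
    using assms by (simp add: ax_A1_def set_vars set_H eqt_def image_iff) blast
  then show ?thesis
    using sat_axioms[of w "doteq \<Delta> u i v j \<^bold>\<and> doteq \<Delta> v j t k \<^bold>\<longrightarrow> doteq \<Delta> u i t k"] assms
    by (auto simp: eqt_def sat_Imp sat_And)
qed

lemma eqt_cong:
  assumes "eqt w u i v j" "eqt w u (i @ [k]) u (i @ [k])" "length j \<le> 2"
  shows "eqt w u (i @ [k]) v (j @ [k])"
proof -
  let ?\<phi> = "doteq \<Delta> u i v j \<^bold>\<and> doteq \<Delta> u (i @ [k]) u (i @ [k]) \<^bold>\<longrightarrow> doteq \<Delta> u (i @ [k]) v (j @ [k])"
  have "?\<phi> \<in> set (ax_A2 \<Delta>)"
    using assms by (cases k; force simp: ax_A2_def set_vars set_H eqt_def)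
  then show ?thesis
    using sat_axioms[of w ?\<phi>] assms by (auto simp: eqt_def sat_Imp sat_And)
qed

lemma eqt_pair:
  assumes "eqt w u i u i" "eqt w v j v j" "t \<noteq> u" "t \<noteq> v"
  shows "\<exists>w'. ag t w w' \<and> eqt w' t [False] u i \<and> eqt w' t [True] v j"
proof -
  let ?\<phi> = "doteq \<Delta> u i u i \<^bold>\<and> doteq \<Delta> v j v j \<^bold>\<longrightarrow>
        Ex t (doteq \<Delta> t [False] u i \<^bold>\<and> doteq \<Delta> t [True] v j)"
  have "?\<phi> \<in> set (ax_A3 \<Delta>)"
    using assms by (simp add: ax_A3_def set_vars set_H eqt_def image_iff) blast
  then have "w \<Turnstile> Ex t (doteq \<Delta> t [False] u i \<^bold>\<and> doteq \<Delta> t [True] v j)"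
    using sat_axioms[of w ?\<phi>] assms by (auto simp: eqt_def sat_Imp sat_And)
  then show ?thesis using assms ag_in by (auto simp: eqt_def sat_Ex_And)
qed

lemma eqt_exists:
  assumes "w \<in> W" shows "\<exists>w'. ag t w w' \<and> eqt w' u [] t []"
proof -
  have "Ex t (doteq \<Delta> u [] t []) \<in> set (ax_A4 \<Delta>)"
    by (auto simp: ax_A4_def set_vars)
  then have "w \<Turnstile> Ex t (doteq \<Delta> u [] t [])" using sat_axioms assms by blast
  then show ?thesis using assms ag_in by (auto simp: eqt_def sat_Ex)
qed

lemma eqt_inv: "eqt w u i v j \<Longrightarrow> ag t w w' \<Longrightarrow> t \<noteq> u \<Longrightarrow> t \<noteq> v \<Longrightarrow> eqt w' u i v j"
  using sat_fv[of t "doteq \<Delta> u i v j" w w'] fv_doteq[of u i v j] ag_in by (auto simp: eqt_def)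

lemma eqt_sym_Nil: "u \<noteq> v \<Longrightarrow> eqt w u [] v [] \<Longrightarrow> eqt w v [] u []"
  by (cases u; cases v; simp add: eqt_def doteq_def doteq_dist_def)

text \<open>For nonempty \<open>j\<close> this is the defining clause; for empty \<open>j\<close>,
  (A4) copies \<open>v\<close> into the third variable. As the right-hand side is symmetric in the
  two terms, symmetry for distinct variables follows.\<close>

lemma eqt_via_third:
  assumes "u \<noteq> v"
  shows "eqt w u i v j \<longleftrightarrow>
    (\<exists>w'. ag (third u v) w w' \<and> eqt w' u i (third u v) [] \<and> eqt w' v j (third u v) [])"
    (is "_ \<longleftrightarrow> ?R")
proof (cases "j = []")
  case False
  have "w \<in> W" if ?R using that ag_in by blast
  moreover have "third u v \<noteq> u" "third u v \<noteq> v" using third_neq by auto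
  ultimately show ?thesis
    using assms False ag_in
    by (auto simp: eqt_def doteq_def doteq_dist_def sat_Ex_And Let_def) blast
next
  case True
  let ?t = "third u v"
  note t = third_neq[of u v]
  show ?thesis
  proof
    assume e: "eqt w u i v j"
    then obtain w' where w': "ag ?t w w'" "eqt w' v [] ?t []" using eqt_exists eqt_def by blast
    then have "eqt w' u i v []" using eqt_inv e True t by blast
    then show ?R using w' True eqt_trans by blast
  next
    assume ?R
    then obtain w' where w': "ag ?t w w'" "eqt w' u i ?t []" "eqt w' v j ?t []" by blast
    then have "eqt w' u i v j" using True eqt_trans eqt_sym_Nil t by metis
    then show "eqt w u i v j" using eqt_inv ag_sym w'(1) t by blast
  qed
qed

lemma eqt_sym_neq: "u \<noteq> v \<Longrightarrow> eqt w u i v j \<Longrightarrow> eqt w v j u i"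
  using eqt_via_third[of u v] eqt_via_third[of v u] by (auto simp: third_commute)

lemma eqt_refl_Nil:
  assumes "w \<in> W" shows "eqt w u [] u []"
proof -
  obtain t where t: "t \<noteq> u" using third_neq by blast
  obtain w' where w': "ag t w w'" "eqt w' u [] t []" using assms eqt_exists by blast
  then have "eqt w' u [] u []" using eqt_sym_neq eqt_trans t by metis
  then show ?thesis using w' t ag_sym eqt_inv by blast
qed

lemma eqt_same_var:
  "eqt w VX i VX j \<longleftrightarrow> (\<exists>w'. ag VY w w' \<and> eqt w' VX [] VY [] \<and> eqt w' VX i VY j)"
  "eqt w VY i VY j \<longleftrightarrow> (\<exists>w'. ag VX w w' \<and> eqt w' VX [] VY [] \<and> eqt w' VX i VY j)"
  "eqt w VZ i VZ j \<longleftrightarrow> (\<exists>w'. ag VX w w' \<and> eqt w' VZ i VX [] \<and> eqt w' VZ j VX [])"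
  using ag_in
  by (auto simp: eqt_def doteq_def doteq_dist_def[of _ _ "[]" _ "[]"] sat_Ex_And) blast+

section \<open>Copying a defined term into another variable, and symmetry\<close>

lemma eqt_copy_weak:
  assumes "eqt w u i u i"
  shows "\<exists>t w'. t \<noteq> u \<and> ag t w w' \<and> eqt w' u i t []"
proof (cases u)
  case VX
  then obtain w1 where w1: "ag VY w w1" "eqt w1 VX i VY i" using assms eqt_same_var(1) by blast
  \<comment> \<open>The definition of the equation supplies the value in \<open>z\<close>, at the
    price of a changed \<open>y\<close>; commutation takes that change back.\<close>
  then obtain w2 where w2: "ag VZ w1 w2" "eqt w2 VX i VZ []" using eqt_via_third[of VX VY w1] by auto
  obtain w3 where "ag VZ w w3" "ag VY w3 w2" using ag_commute w1 w2 by blast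
  then have "eqt w3 VX i VZ []" using w2 eqt_inv ag_sym by blast
  then show ?thesis using VX \<open>ag VZ w w3\<close> by blast
next
  case VY
  then obtain w1 where w1: "ag VX w w1" "eqt w1 VX i VY i" using assms eqt_same_var(2) by blast
  then obtain w2 where w2: "ag VZ w1 w2" "eqt w2 VY i VZ []" using eqt_via_third[of VX VY w1] by auto
  obtain w3 where "ag VZ w w3" "ag VX w3 w2" using ag_commute w1 w2 by blast
  then have "eqt w3 VY i VZ []" using w2 eqt_inv ag_sym by blast
  then show ?thesis using VY \<open>ag VZ w w3\<close> by blast
next
  case VZ
  then show ?thesis using assms eqt_same_var(3) by blast
qed

text \<open>The definition of the equation dictates the variable \<open>s\<close> that receives the
  value. From there (A4) passes it on to \<open>t\<close>, and commutation discards the change of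
  \<open>s\<close>.\<close>

lemma eqt_copy:
  assumes "eqt w u i u i" "t \<noteq> u"
  shows "\<exists>w'. ag t w w' \<and> eqt w' t [] u i"
proof -
  obtain s w1 where w1: "s \<noteq> u" "ag s w w1" "eqt w1 u i s []" using eqt_copy_weak[OF assms(1)] by blast
  show ?thesis
  proof (cases "s = t")
    case True
    then show ?thesis using w1 eqt_sym_neq by metis
  next
    case False
    obtain w2 where w2: "ag t w1 w2" "eqt w2 s [] t []" using eqt_exists w1 ag_in by blast
    then have "eqt w2 u i s []" using eqt_inv w1 assms False by metis
    then have e: "eqt w2 t [] u i" using eqt_trans w2 eqt_sym_neq assms by metis
    obtain w3 where "ag t w w3" "ag s w3 w2" using ag_commute w1 w2 by blast
    then show ?thesis using e eqt_inv ag_sym False w1(1) by metis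
  qed
qed

text \<open>The recursion of \<open>doteq_var\<close> strips the last index and quantifies over a
  value of the shorter term, so definedness passes to prefixes.\<close>

lemma eqt_prefix_neq:
  assumes "eqt w u (i @ [k]) v []" "u \<noteq> v"
  shows "eqt w u i u i"
proof (cases "i = []")
  case True
  then show ?thesis using assms eqt_refl_Nil by (auto simp: eqt_def)
next
  case False
  let ?t = "third u v"
  have "doteq_var \<Delta> u (i @ [k]) v = Ex ?t (doteq_var \<Delta> u i ?t \<^bold>\<and> sim_sub \<Delta> (proj \<Delta> k) ?t v)"
    using False by (cases i; cases "tl i") (simp_all add: Let_def)
  then obtain w' where w': "ag ?t w w'" "w' \<Turnstile> doteq_var \<Delta> u i ?t"
    using assms by (auto simp: eqt_def doteq_def doteq_dist_def sat_Ex_And)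
  then have "eqt w' u i ?t []"
    using assms third_neq[of u v] ag_in by (auto simp: eqt_def doteq_def doteq_dist_def)
  then have "eqt w' u i u i" using eqt_sym_neq eqt_trans third_neq by metis
  then show ?thesis using eqt_inv ag_sym w' third_neq by metis
qed

lemma eqt_prefix_refl:
  assumes "eqt w u (i @ [k]) u (i @ [k])"
  shows "eqt w u i u i"
proof -
  obtain t w' where "t \<noteq> u" "ag t w w'" "eqt w' u (i @ [k]) t []"
    using eqt_copy_weak assms by blast
  then show ?thesis using eqt_prefix_neq eqt_inv ag_sym by metis
qed

lemma eqt_cong_Nil:
  "eqt w u [] v [] \<Longrightarrow> eqt w u i u i \<Longrightarrow> eqt w u i v i"
proof (induction i rule: rev_induct)
  case (snoc k i)
  then have "eqt w u i v i" using eqt_prefix_refl by blast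
  then show ?case using eqt_cong snoc by (auto simp: eqt_def)
qed

lemma eqt_sym:
  assumes "eqt w u i v j" shows "eqt w v j u i"
proof (cases "u = v")
  case False
  then show ?thesis using assms eqt_sym_neq by blast
next
  case True
  show ?thesis
  proof (cases u)
    case VX
    then obtain w' where w': "ag VY w w'" "eqt w' VX [] VY []" "eqt w' VX i VY j"
      using assms True eqt_same_var by blast
    \<comment> \<open>At \<open>w'\<close> the variables \<open>x\<close> and \<open>y\<close> are
      equal, so equal indices may be exchanged between them by \<open>eqt_cong_Nil\<close>; this
      turns symmetry across two variables into symmetry within \<open>x\<close>.\<close>
    have yx: "eqt w' VY j VX i" "eqt w' VY [] VX []" using w' eqt_sym_neq by auto
    then have "eqt w' VY j VX j" using eqt_cong_Nil eqt_trans w' by blast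
    then have "eqt w' VX j VX i" using eqt_sym_neq[of VY VX] yx eqt_trans by blast
    then show ?thesis using VX True w' eqt_inv[of w' VX j VX i VY w] ag_sym by blast
  next
    case VY
    then obtain w' where w': "ag VX w w'" "eqt w' VX [] VY []" "eqt w' VX i VY j"
      using assms True eqt_same_var by blast
    have yx: "eqt w' VY j VX i" using w' eqt_sym_neq by auto
    then have "eqt w' VX i VY i" using eqt_cong_Nil eqt_trans w' by blast
    then have "eqt w' VY j VY i" using yx eqt_trans by blast
    then show ?thesis using VY True w' eqt_inv[of w' VY j VY i VX w] ag_sym by blast
  next
    case VZ
    then show ?thesis using assms True eqt_same_var(3) by blast
  qed
qed

lemma eqt_refl: "eqt w u i v j \<Longrightarrow> eqt w u i u i"
  using eqt_sym eqt_trans by blast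

lemma eqt_refl': "eqt w u i v j \<Longrightarrow> eqt w v j v j"
  using eqt_sym eqt_trans by blast

lemma eqt_prefix: "eqt w u (i @ [k]) v j \<Longrightarrow> eqt w u i u i"
  using eqt_refl eqt_prefix_refl by blast

lemma eqt_child:
  assumes "eqt w u i v j" "eqt w u (i @ [k]) t l" "length j \<le> 2"
  shows "eqt w v (j @ [k]) t l"
  using assms eqt_cong eqt_refl eqt_sym eqt_trans by meson

section \<open>Unary predicates evaluated at terms\<close>

text \<open>Instances for literal index lists, with which the pattern \<open>i @ [k]\<close> does
  not unify.\<close>

lemmas eqt_children =
  eqt_child[where i = "[]" and j = "[]", simplified]
  eqt_child[where i = "[]" and j = "[l1]" for l1, simplified]
  eqt_child[where i = "[k1]" and j = "[l1]" for k1 l1, simplified]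
  eqt_child[where i = "[k1, k2]" and j = "[l1, l2]" for k1 k2 l1 l2, simplified]

lemma ag_switch: "ag v w w1 \<Longrightarrow> ag v w w' \<Longrightarrow> ag v w' w1"
  using ag_sym ag_trans by blast

definition unary :: "('w \<Rightarrow> bool) \<Rightarrow> bool" where
  "unary P \<longleftrightarrow> (\<forall>v w w'. v \<noteq> VX \<longrightarrow> ag v w w' \<longrightarrow> P w \<longrightarrow> P w')"

text \<open>The predicate \<open>P\<close> of \<open>x\<close> holds of some element equal to \<open>u\<^sub>i\<close>. Since \<open>P\<close> need not respect
  simulated equality, the value at \<open>x\<close> itself is saturated through \<open>y\<close>.\<close>

definition At :: "('w \<Rightarrow> bool) \<Rightarrow> var \<Rightarrow> bool list \<Rightarrow> 'w \<Rightarrow> bool" where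
  "At P u i w \<longleftrightarrow>
    (if u = VX
     then \<exists>w'. ag VY w w' \<and> eqt w' VY [] VX i \<and> (\<exists>w''. ag VX w' w'' \<and> eqt w'' VX [] VY [] \<and> P w'')
     else \<exists>w'. ag VX w w' \<and> eqt w' VX [] u i \<and> P w')"

text \<open>Families \<open>F u i\<close> that depend only on the value of the term \<open>u\<^sub>i\<close>, for indices of length at
  most \<open>n\<close>.\<close>

definition property :: "nat \<Rightarrow> (var \<Rightarrow> bool list \<Rightarrow> 'w \<Rightarrow> bool) \<Rightarrow> bool" where
  "property n F \<longleftrightarrow>
    (\<forall>u i w. length i \<le> n \<longrightarrow> F u i w \<longrightarrow> eqt w u i u i) \<and>
    (\<forall>u i v w w'. length i \<le> n \<longrightarrow> v \<noteq> u \<longrightarrow> ag v w w' \<longrightarrow> F u i w \<longrightarrow> F u i w') \<and>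
    (\<forall>u i v j w. length i \<le> n \<longrightarrow> length j \<le> n \<longrightarrow> eqt w u i v j \<longrightarrow> F u i w \<longrightarrow> F v j w)"

lemma At_VX: "At P VX i w \<longleftrightarrow> (\<exists>w'. ag VY w w' \<and> eqt w' VY [] VX i \<and> At P VY [] w')"
  by (simp add: At_def)

lemma At_neq: "u \<noteq> VX \<Longrightarrow> At P u i w \<longleftrightarrow> (\<exists>w'. ag VX w w' \<and> eqt w' VX [] u i \<and> P w')"
  by (simp add: At_def)

lemma At_refl: "At P u i w \<Longrightarrow> eqt w u i u i"
  unfolding At_def using eqt_refl' eqt_inv ag_sym by (metis var.distinct(1))

lemma At_inv_neq:
  assumes "unary P" "u \<noteq> VX" "At P u i w" "ag v w w'" "v \<noteq> u"
  shows "At P u i w'"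
proof -
  obtain w1 where w1: "ag VX w w1" "eqt w1 VX [] u i" "P w1" using assms At_neq by blast
  show ?thesis
  proof (cases "v = VX")
    case True
    then have "ag VX w' w1" using ag_switch w1 assms by blast
    then show ?thesis using w1 assms(2) At_neq by blast
  next
    case False
    obtain w2 where "ag VX w' w2" "ag v w2 w1" using ag_commute[OF ag_sym[OF assms(4)] w1(1)] by blast
    moreover have "eqt w2 VX [] u i" using calculation(2) w1 eqt_inv ag_sym False assms(5) by metis
    moreover have "P w2" using calculation(2) ag_sym w1 assms(1) False unfolding unary_def by blast
    ultimately show ?thesis using assms(2) At_neq by blast
  qed
qed

lemma At_inv:
  assumes "unary P" "At P u i w" "ag v w w'" "v \<noteq> u"
  shows "At P u i w'"
proof (cases "u = VX")
  case False
  then show ?thesis using At_inv_neq assms by blast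
next
  case True
  obtain w1 where w1: "ag VY w w1" "eqt w1 VY [] VX i" "At P VY [] w1" using assms At_VX True by blast
  show ?thesis
  proof (cases "v = VY")
    case True
    then have "ag VY w' w1" using ag_switch w1 assms by blast
    then show ?thesis using w1 At_VX \<open>u = VX\<close> by blast
  next
    case False
    obtain w2 where w2: "ag VY w' w2" "ag v w2 w1" using ag_commute[OF ag_sym[OF assms(3)] w1(1)] by blast
    have "eqt w2 VY [] VX i" using w2 w1 eqt_inv ag_sym False assms(4) True by metis
    moreover have "At P VY [] w2" using At_inv_neq[OF assms(1) _ w1(3)] ag_sym w2 False by blast
    ultimately show ?thesis using At_VX w2 True by blast
  qed
qed

lemma At_ext_neq:
  assumes "u \<noteq> VX" "v \<noteq> VX" "eqt w u i v j" "At P u i w"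
  shows "At P v j w"
proof -
  obtain w' where w': "ag VX w w'" "eqt w' VX [] u i" "P w'" using assms At_neq by blast
  have "eqt w' VX [] v j" using eqt_trans[OF w'(2) eqt_inv[OF assms(3) w'(1)]] assms by blast
  then show ?thesis using w' assms(2) At_neq by blast
qed

text \<open>Removes the case distinction from \<open>At\<close>: the term may be copied into any
  variable other than \<open>x\<close> and its own.\<close>

lemma At_via:
  assumes P: "unary P" and c: "c \<noteq> VX" "c \<noteq> u"
  shows "At P u i w \<longleftrightarrow> (\<exists>w'. ag c w w' \<and> eqt w' c [] u i \<and> At P c [] w')"
proof (cases "u = VX")
  case False
  show ?thesis
  proof
    assume a: "At P u i w"
    then obtain w' where w': "ag c w w'" "eqt w' c [] u i" using eqt_copy At_refl c by blast
    then have "At P u i w'" using At_inv[OF P a] c by blast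
    then show "\<exists>w'. ag c w w' \<and> eqt w' c [] u i \<and> At P c [] w'"
      using At_ext_neq w' False c eqt_sym by blast
  next
    assume "\<exists>w'. ag c w w' \<and> eqt w' c [] u i \<and> At P c [] w'"
    then show "At P u i w" using At_ext_neq At_inv[OF P] False c ag_sym by blast
  qed
next
  case True
  \<comment> \<open>For terms of \<open>x\<close> the definition goes through \<open>y\<close>; an
    evaluation through either of \<open>y\<close>, \<open>z\<close> is exchanged for one through the
    other.\<close>
  have move: "\<exists>w'. ag d w w' \<and> eqt w' d [] VX i \<and> At P d [] w'"
    if w1: "ag e w w1" "eqt w1 e [] VX i" "At P e [] w1" and de: "d \<noteq> VX" "e \<noteq> VX" "d \<noteq> e" for d e w1
  proof -
    obtain w2 where w2: "ag d w1 w2" "eqt w2 d [] e []"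
      using eqt_copy[of w1 e "[]" d] de w1 eqt_refl by blast
    have "At P d [] w2" using At_inv[OF P w1(3) w2(1)] At_ext_neq w2 eqt_sym de by metis
    moreover have "eqt w2 d [] VX i" using eqt_inv w1 w2 eqt_trans de by metis
    moreover obtain w3 where "ag d w w3" "ag e w3 w2" using ag_commute w1 w2 by blast
    ultimately show ?thesis using At_inv[OF P] eqt_inv ag_sym de by metis
  qed
  have "c = VY \<or> c = VZ" using c by (cases c) auto
  then show ?thesis
    unfolding True At_VX using move[of VY _ VZ] move[of VZ _ VY] by auto
qed

lemma At_ext:
  assumes P: "unary P" and e: "eqt w u i v j" and a: "At P u i w"
  shows "At P v j w"
proof (cases "u \<noteq> VX \<and> v \<noteq> VX")
  case True
  then show ?thesis using At_ext_neq e a by blast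
next
  case False
  \<comment> \<open>One of \<open>u\<close>, \<open>v\<close> is \<open>x\<close>, so a variable
    outside all three names remains.\<close>
  then obtain c where c: "c \<noteq> VX" "c \<noteq> u" "c \<noteq> v"
    by (cases u; cases v) auto
  then obtain w' where w': "ag c w w'" "eqt w' c [] u i" "At P c [] w'" using At_via[OF P] a by blast
  then have "eqt w' c [] v j" using eqt_trans eqt_inv e c by metis
  then show ?thesis using At_via[OF P] c w' by blast
qed

text \<open>An inclusion only: saturating under simulated equality may enlarge
  \<open>P\<close>.\<close>

lemma At_VX_I:
  assumes "P w" "w \<in> W" "unary P" shows "At P VX [] w"
proof -
  obtain w' where w': "ag VY w w'" "eqt w' VY [] VX []" using eqt_copy[OF eqt_refl_Nil] assms by blast
  then have "P w'" using assms unfolding unary_def by blast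
  then show ?thesis unfolding At_VX using w' ag_refl[of w' VX] ag_in eqt_sym by (force simp: At_def)
qed

text \<open>The substitution lemma for all operations below: a family that survives copying can be
  evaluated at a term by writing the term into it, with no detour through \<open>x\<close>.\<close>

lemma At_property:
  assumes "property n F" "P = F VX []" "length i \<le> n"
  shows "At P u i w \<longleftrightarrow> F u i w"
proof -
  have r: "F u i w \<Longrightarrow> length i \<le> n \<Longrightarrow> eqt w u i u i"
    and inv: "F u i w \<Longrightarrow> length i \<le> n \<Longrightarrow> ag v w w' \<Longrightarrow> v \<noteq> u \<Longrightarrow> F u i w'"
    and ext: "eqt w u i v j \<Longrightarrow> F u i w \<Longrightarrow> length i \<le> n \<Longrightarrow> length j \<le> n \<Longrightarrow> F v j w" for u i v j w w'
    using assms(1) unfolding property_def by blast+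
  have via: "F u i w \<longleftrightarrow> (\<exists>w'. ag c w w' \<and> eqt w' c [] u i \<and> F c [] w')"
    if cu: "c \<noteq> u" and len: "length i \<le> n" for c u i w
  proof
    assume a: "F u i w"
    then obtain w' where w': "ag c w w'" "eqt w' c [] u i" using eqt_copy r cu len by blast
    then show "\<exists>w'. ag c w w' \<and> eqt w' c [] u i \<and> F c [] w'"
      using ext[OF eqt_sym] inv[OF a] that by (metis le0 list.size(3))
  next
    assume "\<exists>w'. ag c w w' \<and> eqt w' c [] u i \<and> F c [] w'"
    then show "F u i w" using ext inv that ag_sym by (metis le0 list.size(3))
  qed
  have neq: "At P u i w \<longleftrightarrow> F u i w" if "u \<noteq> VX" "length i \<le> n" for u i w
    using via[of VX u i w] that assms(2) by (simp add: At_neq)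
  show ?thesis
  proof (cases "u = VX")
    case True
    then show ?thesis using via[of VY VX i w] neq[of VY "[]"] assms(3) by (simp add: At_VX)
  qed (use neq assms in blast)
qed

lemma property_unary: "property n F \<Longrightarrow> unary (F VX [])"
  unfolding property_def unary_def by fastforce

lemma At_disj: "At (\<lambda>w. P w \<or> Q w) u i w \<longleftrightarrow> At P u i w \<or> At Q u i w"
  unfolding At_def by auto

section \<open>Binary relations coded by unary predicates of pairs\<close>

text \<open>Some pair in \<open>P\<close> has the components \<open>u\<^sub>i\<close> and \<open>u\<^sub>j\<close>. Both terms must use the same variable:
  with only three variables at hand a relation between two variables cannot be renamed.\<close>

definition Rel :: "('w \<Rightarrow> bool) \<Rightarrow> var \<Rightarrow> bool list \<Rightarrow> bool list \<Rightarrow> 'w \<Rightarrow> bool" where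
  "Rel P u i j w \<longleftrightarrow> (\<exists>c w'. c \<noteq> u \<and> ag c w w' \<and> At P c [] w' \<and> eqt w' c [False] u i \<and> eqt w' c [True] u j)"

lemma Rel_refl: "Rel P u i j w \<Longrightarrow> eqt w u i u i" "Rel P u i j w \<Longrightarrow> eqt w u j u j"
  unfolding Rel_def using eqt_refl' eqt_inv ag_sym by metis+

text \<open>The pair may be held by any variable other than \<open>u\<close>: it is copied from
  \<open>c\<close> to \<open>d\<close>, and commutation undoes the change of
  \<open>c\<close>.\<close>

lemma Rel_get:
  assumes P: "unary P" and Rel: "Rel P u i j w" and d: "d \<noteq> u"
  shows "\<exists>w'. ag d w w' \<and> At P d [] w' \<and> eqt w' d [False] u i \<and> eqt w' d [True] u j"
proof -
  obtain c w1 where c: "c \<noteq> u" "ag c w w1" "At P c [] w1" "eqt w1 c [False] u i" "eqt w1 c [True] u j"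
    using Rel Rel_def by blast
  show ?thesis
  proof (cases "c = d")
    case True
    then show ?thesis using c by blast
  next
    case False
    obtain w2 where w2: "ag d w1 w2" "eqt w2 d [] c []" using eqt_copy[OF At_refl[OF c(3)]] False by metis
    have "At P c [] w2" using At_inv[OF P] c w2 False by metis
    then have a: "At P d [] w2" using At_ext[OF P] eqt_sym w2 by blast
    have "eqt w2 c [False] u i" "eqt w2 c [True] u j" using eqt_inv c w2 False d by metis+
    then have e: "eqt w2 d [False] u i" "eqt w2 d [True] u j"
      using eqt_children(1) w2 eqt_sym by blast+
    obtain w3 where "ag d w w3" "ag c w3 w2" using ag_commute c w2 by blast
    then show ?thesis using a e At_inv[OF P] eqt_inv ag_sym c False by metis
  qed
qed

lemma Rel_inv:
  assumes "unary P" "Rel P u i j w" "ag v w w'" "v \<noteq> u"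
  shows "Rel P u i j w'"
proof -
  obtain w1 where w1: "ag v w w1" "At P v [] w1" "eqt w1 v [False] u i" "eqt w1 v [True] u j"
    using Rel_get assms by blast
  then have "ag v w' w1" using ag_switch assms by blast
  then show ?thesis unfolding Rel_def using assms w1 by blast
qed

lemma Rel_ext:
  assumes "unary P" "Rel P u i j w" "eqt w u i v i'" "eqt w u j v j'"
  shows "Rel P v i' j' w"
proof -
  let ?c = "third u v"
  have c: "?c \<noteq> u" "?c \<noteq> v" using third_neq by auto
  obtain w1 where w1: "ag ?c w w1" "At P ?c [] w1" "eqt w1 ?c [False] u i" "eqt w1 ?c [True] u j"
    using Rel_get assms c by blast
  then have "eqt w1 ?c [False] v i'" "eqt w1 ?c [True] v j'"
    using eqt_trans eqt_inv assms(3,4) c by metis+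
  then show ?thesis unfolding Rel_def using w1 c by blast
qed

lemma Rel_At:
  assumes P: "unary P" and a: "At P u i w"
    and r: "eqt w u (i @ [False]) u (i @ [False])" "eqt w u (i @ [True]) u (i @ [True])"
  shows "Rel P u (i @ [False]) (i @ [True]) w"
proof -
  let ?c = "third u u"
  have c: "?c \<noteq> u" using third_neq by auto
  obtain w1 where w1: "ag ?c w w1" "eqt w1 ?c [] u i" using eqt_copy[OF At_refl[OF a] c] by blast
  have "At P ?c [] w1" using At_inv[OF P a w1(1) c] At_ext[OF P] eqt_sym w1 by blast
  moreover have "eqt w1 ?c [False] u (i @ [False])" "eqt w1 ?c [True] u (i @ [True])"
    using eqt_child[OF eqt_sym[OF w1(2)] eqt_inv[OF r(1) w1(1) c c]]
      eqt_child[OF eqt_sym[OF w1(2)] eqt_inv[OF r(2) w1(1) c c]] by auto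
  ultimately show ?thesis unfolding Rel_def using w1 c by blast
qed

lemma Rel_disj: "Rel (\<lambda>w. P w \<or> Q w) u i j w \<longleftrightarrow> Rel P u i j w \<or> Rel Q u i j w"
  unfolding Rel_def At_disj by blast

text \<open>The predicates that represent binary relations: those invariant under replacing \<open>x\<close> by
  another pair with the same components.\<close>

definition extensional :: "('w \<Rightarrow> bool) \<Rightarrow> bool" where
  "extensional P \<longleftrightarrow> unary P \<and> P = Rel P VX [False] [True]"

lemma extensional_unary: "extensional P \<Longrightarrow> unary P"
  by (simp add: extensional_def)

text \<open>The bound is 2 because one index is appended. The two orders of \<open>k\<close> and
  \<open>l\<close> serve extensional predicates and converses.\<close>

lemma property_Rel_components:
  assumes P: "unary P"
  shows "property 2 (\<lambda>u i. Rel P u (i @ [k]) (i @ [l]))"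
  unfolding property_def
proof (intro conjI allI impI)
  show "eqt w u i u i" if "Rel P u (i @ [k]) (i @ [l]) w" for u i w
    using eqt_prefix Rel_refl that by blast
  show "Rel P u (i @ [k]) (i @ [l]) w'" if "v \<noteq> u" "ag v w w'" "Rel P u (i @ [k]) (i @ [l]) w" for u i v w w'
    using Rel_inv[OF P] that by blast
  show "Rel P v (j @ [k]) (j @ [l]) w"
    if l: "length i \<le> 2" "length j \<le> 2" and e: "eqt w u i v j" and b: "Rel P u (i @ [k]) (i @ [l]) w" for u i v j w
    using Rel_ext[OF P b] eqt_child[OF e _ l(2)] eqt_sym Rel_refl[OF b] by blast
qed

lemma extensional_At:
  assumes "extensional P" "length i \<le> 2"
  shows "At P u i w \<longleftrightarrow> Rel P u (i @ [False]) (i @ [True]) w"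
  using assms At_property[OF property_Rel_components[of P False True], of P i u w]
  by (simp add: extensional_def)

lemma extensionalI: "unary P \<Longrightarrow> (\<And>w. Rel P VX [False] [True] w \<longleftrightarrow> P w) \<Longrightarrow> extensional P"
  unfolding extensional_def by blast

lemma extensional_Rel: "extensional P \<Longrightarrow> Rel P VX [False] [True] = P"
  by (simp add: extensional_def)

lemma extensional_eqI:
  assumes "extensional P" "extensional Q" "\<And>w. Rel P VX [False] [True] w \<longleftrightarrow> Rel Q VX [False] [True] w"
  shows "P = Q"
proof -
  have "P = Rel P VX [False] [True]" by (rule extensional_Rel[OF assms(1), symmetric])
  also have "\<dots> = Rel Q VX [False] [True]" using assms(3) by blast
  also have "\<dots> = Q" by (rule extensional_Rel[OF assms(2)])
  finally show ?thesis .
qed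

section \<open>Composition\<close>

text \<open>The matrix of \<open>comp_fm\<close>, with \<open>c\<close> in the place of
  \<open>y\<close> and the term \<open>u_i\<close> in the place of \<open>x\<close>.\<close>

definition splits :: "('w \<Rightarrow> bool) \<Rightarrow> ('w \<Rightarrow> bool) \<Rightarrow> var \<Rightarrow> var \<Rightarrow> bool list \<Rightarrow> 'w \<Rightarrow> bool" where
  "splits P Q c u i w \<longleftrightarrow> At P c [False] w \<and> At Q c [True] w \<and>
     eqt w u (i @ [False]) c [False, False] \<and> eqt w c [False, True] c [True, False] \<and>
     eqt w c [True, True] u (i @ [True])"

definition Comp :: "('w \<Rightarrow> bool) \<Rightarrow> ('w \<Rightarrow> bool) \<Rightarrow> 'w \<Rightarrow> bool" where
  "Comp P Q w \<longleftrightarrow> (\<exists>w'. ag VY w w' \<and> splits P Q VY VX [] w')"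

definition Comp_at :: "('w \<Rightarrow> bool) \<Rightarrow> ('w \<Rightarrow> bool) \<Rightarrow> var \<Rightarrow> bool list \<Rightarrow> 'w \<Rightarrow> bool" where
  "Comp_at P Q u i w \<longleftrightarrow> (\<exists>c w'. c \<noteq> u \<and> ag c w w' \<and> splits P Q c u i w')"

context
  fixes P Q assumes P: "unary P" and Q: "unary Q"
begin

lemma splits_inv:
  assumes "splits P Q c u i w" "ag v w w'" "v \<noteq> c" "v \<noteq> u"
  shows "splits P Q c u i w'"
  using assms(1) At_inv[OF P _ assms(2,3)] At_inv[OF Q _ assms(2,3)] eqt_inv[OF _ assms(2)] assms(3,4)
  by (simp add: splits_def)

lemma splits_copy:
  assumes "splits P Q c u i w" "eqt w c [] d []"
  shows "splits P Q d u i w"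
proof -
  have s: "At P c [False] w" "At Q c [True] w" "eqt w u (i @ [False]) c [False, False]"
    "eqt w c [False, True] c [True, False]" "eqt w c [True, True] u (i @ [True])"
    using assms(1) by (auto simp: splits_def)
  have e: "eqt w c [False] d [False]" "eqt w c [True] d [True]"
    using eqt_children(1)[OF assms(2) At_refl[OF s(1)]] eqt_children(1)[OF assms(2) At_refl[OF s(2)]] eqt_sym by blast+
  note f = eqt_children(3)[OF e(1)] eqt_children(3)[OF e(2)]
  have "At P d [False] w" "At Q d [True] w" using At_ext[OF P] At_ext[OF Q] e s(1,2) by blast+
  moreover have "eqt w u (i @ [False]) d [False, False]" using f(1) s(3) eqt_sym by blast
  moreover have "eqt w d [False, True] d [True, False]" using f(1)[OF s(4)] f(2) eqt_sym by blast
  moreover have "eqt w d [True, True] u (i @ [True])" using f(2)[OF s(5)] .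
  ultimately show ?thesis by (simp add: splits_def)
qed

lemma splits_components:
  assumes "splits P Q c u i w" "eqt w u (i @ [False]) v (j @ [False])" "eqt w u (i @ [True]) v (j @ [True])"
  shows "splits P Q c v j w"
  using assms(1) eqt_trans[OF eqt_sym[OF assms(2)]] eqt_trans[OF _ assms(3)] unfolding splits_def by blast

lemma Comp_at_get:
  assumes "Comp_at P Q u i w" "d \<noteq> u"
  shows "\<exists>w'. ag d w w' \<and> splits P Q d u i w'"
proof -
  obtain c w1 where c: "c \<noteq> u" "ag c w w1" "splits P Q c u i w1" using assms Comp_at_def by blast
  show ?thesis
  proof (cases "c = d")
    case False
    obtain w2 where w2: "ag d w1 w2" "eqt w2 c [] d []" using eqt_exists c ag_in by blast
    then have s: "splits P Q d u i w2" using splits_copy splits_inv[OF c(3)] False assms(2) by metis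
    obtain w3 where "ag d w w3" "ag c w3 w2" using ag_commute c w2 by blast
    then show ?thesis using splits_inv[OF s] ag_sym c False by metis
  qed (use c in blast)
qed

lemma property_Comp_at: "property 2 (Comp_at P Q)"
  unfolding property_def
proof (intro conjI allI impI)
  show "eqt w u i u i" if "Comp_at P Q u i w" for u i w
    using that unfolding Comp_at_def splits_def by (metis eqt_prefix eqt_inv ag_sym)
  show "Comp_at P Q u i w'" if "v \<noteq> u" "ag v w w'" "Comp_at P Q u i w" for u i v w w'
    using Comp_at_get[OF that(3,1)] that(1) ag_switch[OF _ that(2)] unfolding Comp_at_def by blast
  show "Comp_at P Q v j w"
    if l: "length i \<le> 2" "length j \<le> 2" and e: "eqt w u i v j" and c: "Comp_at P Q u i w" for u i v j w
  proof -
    let ?c = "third u v"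
    have n: "?c \<noteq> u" "?c \<noteq> v" using third_neq by auto
    obtain w1 where w1: "ag ?c w w1" "splits P Q ?c u i w1" using Comp_at_get[OF c n(1)] by blast
    have e1: "eqt w1 u i v j" using eqt_inv e w1 n by blast
    have "eqt w1 u (i @ [False]) u (i @ [False])" "eqt w1 u (i @ [True]) u (i @ [True])"
      using w1(2) eqt_refl[of w1 u "i @ [False]"] eqt_refl'[of w1 _ _ u "i @ [True]"]
      unfolding splits_def by blast+
    then have "splits P Q ?c v j w1"
      by (intro splits_components[OF w1(2)] eqt_sym[OF eqt_child[OF e1 _ l(2)]])
    then show ?thesis unfolding Comp_at_def using w1 n by blast
  qed
qed

lemma Comp_eq: "Comp P Q = Comp_at P Q VX []"
proof (intro ext iffI)
  show "Comp_at P Q VX [] w" if "Comp P Q w" for w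
    using that unfolding Comp_def Comp_at_def by (metis var.distinct(1))
  show "Comp P Q w" if "Comp_at P Q VX [] w" for w
    using Comp_at_get[OF that, of VY] by (simp add: Comp_def)
qed

lemma unary_Comp: "unary (Comp P Q)"
  using property_unary[OF property_Comp_at] Comp_eq by simp

lemma At_Comp: "length i \<le> 2 \<Longrightarrow> At (Comp P Q) u i w \<longleftrightarrow> Comp_at P Q u i w"
  using At_property[OF property_Comp_at Comp_eq] by blast

lemmas Comp_at_inv = property_Comp_at[unfolded property_def, THEN conjunct2, THEN conjunct1, rule_format]
lemmas Comp_at_ext = property_Comp_at[unfolded property_def, THEN conjunct2, THEN conjunct2, rule_format]

text \<open>The witness is the pair of \<open>u_i\<close> and \<open>v_j\<close>, which (A3) packs
  into a variable occurring in none of the terms.\<close>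

lemma Comp_at_I:
  assumes a: "At P u i w" "At Q v j w"
    and e: "eqt w u (i @ [True]) v (j @ [False])" "eqt w t (k @ [False]) u (i @ [False])"
      "eqt w t (k @ [True]) v (j @ [True])"
    and c: "c \<noteq> u" "c \<noteq> v" "c \<noteq> t"
  shows "Comp_at P Q t k w"
proof -
  obtain w1 where w1: "ag c w w1" "eqt w1 c [False] u i" "eqt w1 c [True] v j"
    using eqt_pair[OF At_refl At_refl] a c by blast
  have a1: "At P u i w1" "At Q v j w1" using At_inv[OF P] At_inv[OF Q] a w1 c by blast+
  have e1: "eqt w1 u (i @ [True]) v (j @ [False])" "eqt w1 t (k @ [False]) u (i @ [False])"
      "eqt w1 t (k @ [True]) v (j @ [True])" using eqt_inv e w1 c by metis+
  have "At P c [False] w1" "At Q c [True] w1" using At_ext[OF P] At_ext[OF Q] a1 w1 eqt_sym by blast+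
  moreover
  have h: "eqt w1 c [k1, l] r m" if "eqt w1 s (p @ [l]) r m" "eqt w1 c [k1] s p" for k1 l s p r m
    using eqt_child[OF eqt_sym[OF that(2)] that(1)] by simp
  have "eqt w1 t (k @ [False]) c [False, False]" by (rule eqt_sym[OF h[OF eqt_sym[OF e1(2)] w1(2)]])
  moreover have "eqt w1 c [False, True] c [True, False]"
    by (rule eqt_sym[OF h[OF eqt_sym[OF h[OF e1(1) w1(2)]] w1(3)]])
  moreover have "eqt w1 c [True, True] t (k @ [True])" by (rule h[OF eqt_sym[OF e1(3)] w1(3)])
  ultimately show ?thesis unfolding Comp_at_def splits_def using w1 c by blast
qed

text \<open>\<open>splits\<close> looks at \<open>x\<close> only through its two components. Thus a
  composition of unary predicates is always extensional, which is why \<open>Dra\<close> contains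
  every composition of formulas in \<open>Fmd1\<close>.\<close>

lemma extensional_Comp: "extensional (Comp P Q)"
  unfolding extensional_def
proof (intro conjI unary_Comp ext iffI)
  fix w assume c: "Comp P Q w"
  then obtain w' where w': "ag VY w w'" "splits P Q VY VX [] w'" using Comp_def by blast
  then have "eqt w' VX [False] VX [False]" "eqt w' VX [True] VX [True]"
    unfolding splits_def by (auto intro: eqt_refl eqt_refl')
  then have "eqt w VX [False] VX [False]" "eqt w VX [True] VX [True]"
    using eqt_inv ag_sym[OF w'(1)] by blast+
  moreover have "At (Comp P Q) VX [] w" using At_VX_I[OF c _ unary_Comp] w' ag_in by blast
  ultimately show "Rel (Comp P Q) VX [False] [True] w" using Rel_At[OF unary_Comp, of VX "[]"] by simp
next
  fix w assume "Rel (Comp P Q) VX [False] [True] w"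
  then obtain w1 where w1: "ag VY w w1" "At (Comp P Q) VY [] w1"
    "eqt w1 VY [False] VX [False]" "eqt w1 VY [True] VX [True]"
    using Rel_get[OF unary_Comp, of VX _ _ w VY] by auto
  then have "Comp_at P Q VY [] w1" using At_Comp by simp
  then obtain w2 where w2: "ag VZ w1 w2" "splits P Q VZ VY [] w2" using Comp_at_get[of VY _ w1 VZ] by auto
  then have "splits P Q VZ VX [] w2"
    using splits_components[OF w2(2), of VX "[]"] eqt_inv[of w1 _ _ _ _ VZ w2] w1 by simp
  then have "Comp_at P Q VX [] w1" unfolding Comp_at_def using w2 by blast
  then have "Comp_at P Q VX [] w" using Comp_at_inv[of "[]" VY VX w1 w] ag_sym w1(1) by simp
  then show "Comp P Q w" using Comp_eq by simp
qed

text \<open>The pair of \<open>u_i\<close> and \<open>u_k\<close> is needed only to reach the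
  witness \<open>b\<close>. After commutation has discarded it, the equations mention
  \<open>u\<close> and \<open>b\<close> alone and the third variable is free again.\<close>

lemma Rel_Comp_E:
  assumes "Rel (Comp P Q) u i k w" "b \<noteq> u"
  shows "\<exists>w'. ag b w w' \<and> At P b [False] w' \<and> At Q b [True] w' \<and> eqt w' u i b [False, False] \<and>
    eqt w' b [False, True] b [True, False] \<and> eqt w' b [True, True] u k"
proof -
  let ?c = "third u b"
  have c: "?c \<noteq> u" "?c \<noteq> b" using third_neq by auto
  obtain w1 where w1: "ag ?c w w1" "At (Comp P Q) ?c [] w1" "eqt w1 ?c [False] u i" "eqt w1 ?c [True] u k"
    using Rel_get[OF unary_Comp assms(1) c(1)] by blast
  have "Comp_at P Q ?c [] w1" using At_Comp w1 by simp
  then obtain w2 where w2: "ag b w1 w2" "splits P Q b ?c [] w2" using Comp_at_get c by metis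
  have s: "At P b [False] w2" "At Q b [True] w2" "eqt w2 ?c [False] b [False, False]"
    "eqt w2 b [False, True] b [True, False]" "eqt w2 b [True, True] ?c [True]"
    using w2 unfolding splits_def by auto
  have e: "eqt w2 ?c [False] u i" "eqt w2 ?c [True] u k"
    using eqt_inv[OF w1(3) w2(1)] eqt_inv[OF w1(4) w2(1)] c assms(2) by metis+
  have e2: "eqt w2 u i b [False, False]" "eqt w2 b [True, True] u k"
    using eqt_trans[OF eqt_sym[OF e(1)] s(3)] eqt_trans[OF s(5) e(2)] by blast+
  obtain w3 where w3: "ag b w w3" "ag ?c w3 w2" using ag_commute w1 w2 by blast
  note a = ag_sym[OF w3(2)]
  show ?thesis
    using w3(1) At_inv[OF P s(1) a c(2)] At_inv[OF Q s(2) a c(2)] eqt_inv[OF s(4) a c(2,2)]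
      eqt_inv[OF e2(1) a c] eqt_inv[OF e2(2) a c(2,1)] by blast
qed

text \<open>The pair \<open>(u\<^sub>i, u\<^sub>k)\<close> and then the triple \<open>((u\<^sub>i, u\<^sub>k), u\<^sub>j)\<close> are packed into one variable, so that
  the other two become free to hold the witnesses of the two premises.\<close>

lemma Rel_Comp_I:
  assumes BP: "Rel P u i j w" and BQ: "Rel Q u j k w"
  shows "Rel (Comp P Q) u i k w"
proof -
  define b where "b = third u u"
  define c where "c = third u b"
  have n: "b \<noteq> u" "c \<noteq> u" "c \<noteq> b" "u \<noteq> b" "u \<noteq> c" "b \<noteq> c"
    using third_neq unfolding b_def c_def by metis+
  obtain w1 where w1: "ag b w w1" "eqt w1 b [False] u i" "eqt w1 b [True] u k"
    using eqt_pair[OF Rel_refl(1)[OF BP] Rel_refl(2)[OF BQ] n(1) n(1)] by blast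
  have "eqt w1 b [] b []" "eqt w1 u j u j"
    using eqt_refl_Nil w1 ag_in eqt_inv[OF Rel_refl(2)[OF BP] w1(1)] n by blast+
  then obtain w2 where w2: "ag c w1 w2" "eqt w2 c [False] b []" "eqt w2 c [True] u j"
    using eqt_pair[of w1 b "[]" u j c] n by blast
  have "eqt w2 b [False] u i" "eqt w2 b [True] u k" using eqt_inv w1 w2 n by metis+
  then have c2: "eqt w2 c [False, False] u i" "eqt w2 c [False, True] u k"
    using eqt_children(2) eqt_sym[OF w2(2)] by blast+
  have "Rel P u i j w2" "Rel Q u j k w2" using Rel_inv[OF P] Rel_inv[OF Q] BP BQ w1(1) w2(1) n by metis+
  then have B2: "Rel P c [False, False] [True] w2" "Rel Q c [True] [False, True] w2"
    using Rel_ext[OF P] Rel_ext[OF Q] c2 w2 eqt_sym by blast+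
  \<comment> \<open>The old \<open>u_i\<close>, \<open>u_k\<close>, \<open>u_j\<close> survive as
    \<open>c_00\<close>, \<open>c_01\<close>, \<open>c_1\<close>, so \<open>u\<close> may be
    overwritten.\<close>
  obtain w3 where w3: "ag u w2 w3" "At P u [] w3" "eqt w3 u [False] c [False, False]" "eqt w3 u [True] c [True]"
    using Rel_get[OF P B2(1) n(5)] by blast
  have "eqt w3 c [False] c [False]" using eqt_inv[OF eqt_refl[OF w2(2)] w3(1)] n by blast
  \<comment> \<open>The new \<open>b\<close> is the pair of \<open>u\<close> and \<open>c_0\<close>:
    one half stores the element of \<open>P\<close>, the other the end points. It carries all the
    data alone, leaving \<open>u\<close> for an element of \<open>Q\<close> and \<open>c\<close> for
    the witness of the composition.\<close>
  then obtain w4 where w4: "ag b w3 w4" "eqt w4 b [False] u []" "eqt w4 b [True] c [False]"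
    using eqt_pair[OF At_refl[OF w3(2)]] n by blast
  have "At P u [] w4" using At_inv[OF P w3(2) w4(1)] n by blast
  then have b4: "At P b [False] w4" using At_ext[OF P] eqt_sym w4(2) by blast
  have "eqt w4 u [False] c [False, False]" "eqt w4 u [True] c [True]" using eqt_inv w3 w4 n by metis+
  then have e1: "eqt w4 b [False, False] c [False, False]" "eqt w4 b [False, True] c [True]"
    using eqt_children(2)[OF eqt_sym[OF w4(2)]] by blast+
  have "eqt w4 c [False, False] c [False, False]" "eqt w4 c [False, True] c [False, True]"
    using eqt_inv[OF eqt_inv[OF eqt_refl[OF c2(1)] w3(1)] w4(1)] eqt_inv[OF eqt_inv[OF eqt_refl[OF c2(2)] w3(1)] w4(1)] n
    by metis+
  then have e2: "eqt w4 b [True, False] c [False, False]" "eqt w4 b [True, True] c [False, True]"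
    using eqt_children(3)[OF eqt_sym[OF w4(3)]] by blast+
  have "Rel Q c [True] [False, True] w4" using Rel_inv[OF Q] B2(2) w3 w4 n by metis
  then have "Rel Q b [False, True] [True, True] w4" using Rel_ext[OF Q] e1 e2 eqt_sym by blast
  then obtain w5 where w5: "ag u w4 w5" "At Q u [] w5" "eqt w5 u [False] b [False, True]"
    "eqt w5 u [True] b [True, True]" using Rel_get[OF Q _ n(4)] by blast
  have "At P b [False] w5" using At_inv[OF P b4 w5(1)] n by blast
  moreover have "eqt w5 b [True, False] b [False, False]"
    using eqt_inv[OF eqt_trans[OF e2(1) eqt_sym[OF e1(1)]] w5(1)] n by blast
  ultimately have "Comp_at P Q b [True] w5"
    using Comp_at_I[OF _ w5(2), of b "[False]" b "[True]" c] eqt_sym w5 n by simp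
  \<comment> \<open>The changes are undone in reverse order: \<open>b_1\<close> equals
    \<open>c_0\<close>, and \<open>c_0\<close> equals the original \<open>b\<close>, the pair of end
    points.\<close>
  then have "Comp_at P Q b [True] w4" using Comp_at_inv[of "[True]" u b w5 w4] ag_sym w5 n by simp
  then have "Comp_at P Q c [False] w4" using Comp_at_ext[OF _ _ w4(3)] by simp
  then have "Comp_at P Q c [False] w2"
    using Comp_at_inv[of "[False]" b c w4 w3] Comp_at_inv[of "[False]" u c w3 w2] ag_sym w4 w3 n by simp
  then have "Comp_at P Q b [] w2" using Comp_at_ext[OF _ _ w2(2)] by simp
  then have "Comp_at P Q b [] w1" using Comp_at_inv[of "[]" c b w2 w1] ag_sym w2 n by simp
  then have "At (Comp P Q) b [] w1" using At_Comp by simp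
  then show ?thesis unfolding Rel_def using w1 n by blast
qed

end

section \<open>Converse, identity, projections and complement\<close>

definition Conv :: "('w \<Rightarrow> bool) \<Rightarrow> 'w \<Rightarrow> bool" where
  "Conv P w \<longleftrightarrow> (\<exists>w'. ag VY w w' \<and> At P VY [] w' \<and> eqt w' VY [False] VX [True] \<and> eqt w' VY [True] VX [False])"

lemma Conv_eq:
  assumes "unary P" shows "Conv P = Rel P VX [True] [False]"
proof (intro ext iffI)
  show "Rel P VX [True] [False] w" if "Conv P w" for w
    using that unfolding Conv_def Rel_def by (metis var.distinct(1))
  show "Conv P w" if "Rel P VX [True] [False] w" for w
    using Rel_get[OF assms that, of VY] by (simp add: Conv_def)
qed

lemma unary_Conv: "unary P \<Longrightarrow> unary (Conv P)"
  using property_unary[OF property_Rel_components[of P True False]] by (simp add: Conv_eq)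

lemma At_Conv:
  assumes "unary P" "length i \<le> 2"
  shows "At (Conv P) u i w \<longleftrightarrow> Rel P u (i @ [True]) (i @ [False]) w"
  using At_property[OF property_Rel_components[of P True False], of "Conv P" i u w] assms
  by (simp add: Conv_eq)

lemma Rel_Conv:
  assumes P: "unary P"
  shows "Rel (Conv P) u i j w \<longleftrightarrow> Rel P u j i w"
proof
  assume b: "Rel (Conv P) u i j w"
  let ?c = "third u u"
  have c: "?c \<noteq> u" "u \<noteq> ?c" using third_neq by metis+
  obtain w1 where w1: "ag ?c w w1" "At (Conv P) ?c [] w1" "eqt w1 ?c [False] u i" "eqt w1 ?c [True] u j"
    using Rel_get[OF unary_Conv[OF P] b c(1)] by blast
  have "Rel P ?c [True] [False] w1" using w1(2) At_Conv[OF P, of "[]"] by simp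
  then have "Rel P u j i w1" using Rel_ext[OF P _ w1(4,3)] by blast
  then show "Rel P u j i w" using Rel_inv[OF P _ ag_sym[OF w1(1)] c(1)] by blast
next
  assume b: "Rel P u j i w"
  let ?c = "third u u"
  have c: "?c \<noteq> u" using third_neq by metis
  obtain w1 where w1: "ag ?c w w1" "eqt w1 ?c [False] u i" "eqt w1 ?c [True] u j"
    using eqt_pair[OF Rel_refl(2)[OF b] Rel_refl(1)[OF b] c c] by blast
  have "Rel P ?c [True] [False] w1"
    by (rule Rel_ext[OF P Rel_inv[OF P b w1(1) c] eqt_sym[OF w1(3)] eqt_sym[OF w1(2)]])
  then have "At (Conv P) ?c [] w1" using At_Conv[OF P, of "[]"] by simp
  then show "Rel (Conv P) u i j w" unfolding Rel_def using w1 c by blast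
qed

lemma extensional_Conv:
  assumes "unary P" shows "extensional (Conv P)"
proof (intro extensionalI unary_Conv assms)
  show "Rel (Conv P) VX [False] [True] w \<longleftrightarrow> Conv P w" for w
    unfolding Rel_Conv[OF assms] by (rule fun_cong[OF Conv_eq[OF assms, symmetric]])
qed

section \<open>Equations between components as relations\<close>

definition Eq_pred :: "bool list \<Rightarrow> bool list \<Rightarrow> 'w \<Rightarrow> bool" where
  "Eq_pred i j w \<longleftrightarrow> eqt w VX i VX j"

lemma eqt_append:
  assumes "eqt w u i v j" "eqt w u (i @ k) t l" "length (j @ k) \<le> 3"
  shows "eqt w v (j @ k) t l"
  using assms(2,3)
proof (induction k arbitrary: t l rule: rev_induct)
  case Nil
  then show ?case using eqt_trans[OF eqt_sym[OF assms(1)]] by simp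
next
  case (snoc b k)
  have "eqt w u (i @ k) u (i @ k)" using eqt_prefix[of w u "i @ k" b t l] snoc.prems by simp
  then have "eqt w u (i @ k) v (j @ k)" using snoc.IH[THEN eqt_sym] snoc.prems by simp
  from eqt_child[OF this, of b t l] show ?case using snoc.prems by simp
qed

lemma eqt_prefix_append: "eqt w u (i @ a) v j \<Longrightarrow> eqt w u i u i"
proof (induction a arbitrary: v j rule: rev_induct)
  case (snoc k a)
  then have "eqt w u (i @ a) u (i @ a)" using eqt_prefix[of w u "i @ a" k v j] by simp
  then show ?case by (rule snoc.IH)
qed (use eqt_refl in simp)

lemma property_eqt:
  assumes "length a + n \<le> 3" "length b + n \<le> 3"
  shows "property n (\<lambda>u i w. eqt w u (i @ a) u (i @ b))"
  unfolding property_def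
proof (intro conjI allI impI)
  show "eqt w u i u i" if "eqt w u (i @ a) u (i @ b)" for u i w
    using eqt_prefix_append[OF that] .
  show "eqt w' u (i @ a) u (i @ b)" if "v \<noteq> u" "ag v w w'" "eqt w u (i @ a) u (i @ b)" for u i v w w'
    using eqt_inv that by blast
  show "eqt w v (j @ a) v (j @ b)"
    if l: "length i \<le> n" "length j \<le> n" and e: "eqt w u i v j" and h: "eqt w u (i @ a) u (i @ b)"
    for u i v j w
  proof -
    have "eqt w v (j @ a) u (i @ b)" using eqt_append[OF e h] l assms by simp
    from eqt_append[OF e eqt_sym[OF this]] show ?thesis using l assms eqt_sym by simp
  qed
qed

lemma unary_Eq_pred: "length a \<le> 3 \<Longrightarrow> length b \<le> 3 \<Longrightarrow> unary (Eq_pred a b)"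
  using property_unary[OF property_eqt[of a 0 b]] by (simp add: Eq_pred_def[abs_def])

lemma At_Eq_pred:
  assumes "length a + length i \<le> 3" "length b + length i \<le> 3"
  shows "At (Eq_pred a b) u i w \<longleftrightarrow> eqt w u (i @ a) u (i @ b)"
  using At_property[OF property_eqt[OF assms], of "Eq_pred a b" i u w]
  by (simp add: Eq_pred_def[abs_def])

text \<open>Covers the identity \<open>x\<^sub>0 \<doteq> x\<^sub>1\<close> (\<open>k\<close> empty) and the quasi-projections \<open>x\<^sub>0\<^sub>0 \<doteq> x\<^sub>1\<close>,
  \<open>x\<^sub>0\<^sub>1 \<doteq> x\<^sub>1\<close>.\<close>

lemma Rel_Eq_pred:
  assumes "length k \<le> 2" "length i + length k \<le> 3"
  shows "Rel (Eq_pred (False # k) [True]) u i j w \<longleftrightarrow> eqt w u i u i \<and> eqt w u (i @ k) u j"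
proof -
  let ?P = "Eq_pred (False # k) [True]"
  let ?c = "third u u"
  have c: "?c \<noteq> u" "u \<noteq> ?c" using third_neq by metis+
  have un: "unary ?P" using unary_Eq_pred assms by simp
  have at: "At ?P ?c [] w1 \<longleftrightarrow> eqt w1 ?c (False # k) ?c [True]" for w1
    using At_Eq_pred[of "False # k" "[]" "[True]" ?c w1] assms by simp
  show ?thesis
  proof
    assume b: "Rel ?P u i j w"
    obtain w1 where w1: "ag ?c w w1" "At ?P ?c [] w1" "eqt w1 ?c [False] u i" "eqt w1 ?c [True] u j"
      using Rel_get[OF un b c(1)] by blast
    have "eqt w1 ?c ([False] @ k) u j" using at w1(2) eqt_trans[OF _ w1(4)] by simp
    then have "eqt w1 u (i @ k) u j" using eqt_append[OF w1(3)] assms by simp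
    then show "eqt w u i u i \<and> eqt w u (i @ k) u j"
      using eqt_inv[OF _ ag_sym[OF w1(1)] c(1,1)] Rel_refl(1)[OF b] by blast
  next
    assume h: "eqt w u i u i \<and> eqt w u (i @ k) u j"
    then have h1: "eqt w u i u i" and h2: "eqt w u (i @ k) u j" by auto
    obtain w1 where w1: "ag ?c w w1" "eqt w1 ?c [False] u i" "eqt w1 ?c [True] u j"
      using eqt_pair[OF h1 eqt_refl'[OF h2] c(1,1)] by blast
    have "eqt w1 u (i @ k) u j" by (rule eqt_inv[OF h2 w1(1) c(1,1)])
    then have "eqt w1 u (i @ k) ?c [True]" by (rule eqt_trans[OF _ eqt_sym[OF w1(3)]])
    then have "eqt w1 ?c ([False] @ k) ?c [True]"
      by (rule eqt_append[OF eqt_sym[OF w1(2)]]) (use assms in simp)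
    then have "At ?P ?c [] w1" using at by simp
    then show "Rel ?P u i j w" unfolding Rel_def using w1 c by blast
  qed
qed

lemma extensional_Eq_pred:
  assumes "length k \<le> 2" shows "extensional (Eq_pred (False # k) [True])"
proof -
  have "eqt w VX [False] VX [False]" if "eqt w VX (False # k) VX [True]" for w
    using eqt_prefix_append[of w VX "[False]" k] that by simp
  then show ?thesis
    unfolding extensional_def using unary_Eq_pred[of "False # k" "[True]"] Rel_Eq_pred[of k "[False]"] assms
    by (auto simp: Eq_pred_def intro!: ext)
qed

section \<open>Complement relative to the pairs\<close>

definition Compl :: "('w \<Rightarrow> bool) \<Rightarrow> 'w \<Rightarrow> bool" where
  "Compl P w \<longleftrightarrow> eqt w VX [False] VX [False] \<and> eqt w VX [True] VX [True] \<and> \<not> P w"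

lemma property_Compl:
  assumes P: "unary P"
  shows "property 2 (\<lambda>u i w. eqt w u (i @ [False]) u (i @ [False]) \<and> eqt w u (i @ [True]) u (i @ [True]) \<and>
    \<not> Rel P u (i @ [False]) (i @ [True]) w)"
  unfolding property_def
proof (intro conjI allI impI; (elim conjE)?)
  fix u i v j w w'
  show "eqt w u i u i" if "eqt w u (i @ [False]) u (i @ [False])"
    using eqt_prefix that by blast
  assume h: "eqt w u (i @ [False]) u (i @ [False])" "eqt w u (i @ [True]) u (i @ [True])"
    "\<not> Rel P u (i @ [False]) (i @ [True]) w"
  {
    assume a: "v \<noteq> u" "ag v w w'"
    show "eqt w' u (i @ [False]) u (i @ [False])" "eqt w' u (i @ [True]) u (i @ [True])"
      using eqt_inv h a by blast+
    show "\<not> Rel P u (i @ [False]) (i @ [True]) w'" using h(3) Rel_inv[OF P _ ag_sym[OF a(2)] a(1)] by blast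
  }
  assume l: "length i \<le> 2" "length j \<le> 2" and e: "eqt w u i v j"
  note g = eqt_child[OF e h(1) l(2)] eqt_child[OF e h(2) l(2)]
  show "eqt w v (j @ [False]) v (j @ [False])" "eqt w v (j @ [True]) v (j @ [True])"
    using g by (auto intro: eqt_refl)
  show "\<not> Rel P v (j @ [False]) (j @ [True]) w" using h(3) Rel_ext[OF P _ g] by blast
qed

lemma Compl_eq:
  assumes "extensional P"
  shows "Compl P = (\<lambda>w. eqt w VX [False] VX [False] \<and> eqt w VX [True] VX [True] \<and>
    \<not> Rel P VX [False] [True] w)"
  using extensional_Rel[OF assms] by (simp add: Compl_def[abs_def])

lemma unary_Compl: "extensional P \<Longrightarrow> unary (Compl P)"
  using property_unary[OF property_Compl[OF extensional_unary]] by (simp add: Compl_eq)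

lemma At_Compl:
  assumes "extensional P" "length i \<le> 2"
  shows "At (Compl P) u i w \<longleftrightarrow> eqt w u (i @ [False]) u (i @ [False]) \<and>
    eqt w u (i @ [True]) u (i @ [True]) \<and> \<not> Rel P u (i @ [False]) (i @ [True]) w"
  using At_property[OF property_Compl[OF extensional_unary[OF assms(1)]], of "Compl P" i u w] assms
  by (simp add: Compl_eq)

text \<open>\<open>Rel\<close> is existential, so negation passes through it only because all pairs
  with the same components agree about an extensional \<open>P\<close>.\<close>

lemma Rel_Compl:
  assumes P: "extensional P"
  shows "Rel (Compl P) u i j w \<longleftrightarrow> eqt w u i u i \<and> eqt w u j u j \<and> \<not> Rel P u i j w"
proof -
  let ?c = "third u u"
  have c: "?c \<noteq> u" "u \<noteq> ?c" using third_neq by metis+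
  note un = extensional_unary[OF P]
  have at: "At (Compl P) ?c [] w1 \<longleftrightarrow> \<not> Rel P u i j w"
    if "ag ?c w w1" "eqt w1 ?c [False] u i" "eqt w1 ?c [True] u j" for w1
  proof -
    have "Rel P ?c [False] [True] w1 \<longleftrightarrow> Rel P u i j w1"
      using Rel_ext[OF un _ that(2,3)] Rel_ext[OF un _ eqt_sym[OF that(2)] eqt_sym[OF that(3)]] by blast
    also have "\<dots> \<longleftrightarrow> Rel P u i j w"
      using Rel_inv[OF un _ that(1) c(1)] Rel_inv[OF un _ ag_sym[OF that(1)] c(1)] by blast
    finally show ?thesis
      using At_Compl[OF P, of "[]" ?c w1] eqt_refl[OF that(2)] eqt_refl[OF that(3)] by simp
  qed
  show ?thesis
  proof
    assume b: "Rel (Compl P) u i j w"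
    obtain w1 where w1: "ag ?c w w1" "At (Compl P) ?c [] w1" "eqt w1 ?c [False] u i" "eqt w1 ?c [True] u j"
      using Rel_get[OF unary_Compl[OF P] b c(1)] by blast
    then show "eqt w u i u i \<and> eqt w u j u j \<and> \<not> Rel P u i j w" using at Rel_refl[OF b] by blast
  next
    assume h: "eqt w u i u i \<and> eqt w u j u j \<and> \<not> Rel P u i j w"
    then obtain w1 where "ag ?c w w1" "eqt w1 ?c [False] u i" "eqt w1 ?c [True] u j"
      using eqt_pair[of w u i u j ?c] c by blast
    then show "Rel (Compl P) u i j w" unfolding Rel_def using at h c by blast
  qed
qed

lemma extensional_Compl: "extensional P \<Longrightarrow> extensional (Compl P)"
  by (rule extensionalI) (simp_all add: unary_Compl Rel_Compl extensional_Rel Compl_def)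

lemma extensional_disj:
  assumes "extensional P" "extensional Q" shows "extensional (\<lambda>w. P w \<or> Q w)"
proof -
  have "unary (\<lambda>w. P w \<or> Q w)"
    using extensional_unary[OF assms(1)] extensional_unary[OF assms(2)] unfolding unary_def by blast
  then show ?thesis
    using extensional_Rel[OF assms(1)] extensional_Rel[OF assms(2)] by (intro extensionalI) (simp_all add: Rel_disj)
qed

section \<open>The laws of relation algebras\<close>

lemma Rel_Comp_Eq:
  assumes P: "unary P"
  shows "Rel (Comp P (Eq_pred [False] [True])) u i j w \<longleftrightarrow> Rel P u i j w"
proof
  have un: "unary (Eq_pred [False] [True])" using unary_Eq_pred by simp
  {
    assume b: "Rel (Comp P (Eq_pred [False] [True])) u i j w"
    let ?b = "third u u"
    have n: "?b \<noteq> u" using third_neq by metis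
    obtain w' where w': "ag ?b w w'" "At P ?b [False] w'" "At (Eq_pred [False] [True]) ?b [True] w'"
      "eqt w' u i ?b [False, False]" "eqt w' ?b [False, True] ?b [True, False]" "eqt w' ?b [True, True] u j"
      using Rel_Comp_E[OF P un b n] by blast
    have "eqt w' ?b [True, False] ?b [True, True]" using At_Eq_pred w'(3) by simp
    then have e: "eqt w' ?b [False, True] u j" using eqt_trans[OF w'(5)] eqt_trans[OF _ w'(6)] by blast
    have "Rel P ?b [False, False] [False, True] w'"
      using Rel_At[OF P w'(2)] eqt_refl'[OF w'(4)] eqt_refl[OF e] by simp
    then have "Rel P u i j w'" using Rel_ext[OF P _ eqt_sym[OF w'(4)] e] by blast
    then show "Rel P u i j w" using Rel_inv[OF P _ ag_sym[OF w'(1)] n] by blast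
  next
    assume b: "Rel P u i j w"
    have "length j \<le> 3" using Rel_refl(2)[OF b] by (simp add: eqt_def)
    then have "Rel (Eq_pred [False] [True]) u j j w" using Rel_Eq_pred[of "[]" j u j w] Rel_refl(2)[OF b] by simp
    then show "Rel (Comp P (Eq_pred [False] [True])) u i j w" using Rel_Comp_I[OF P un b] by blast
  }
qed

lemma Comp_Eq: "extensional P \<Longrightarrow> Comp P (Eq_pred [False] [True]) = P"
  by (intro extensional_eqI extensional_Comp Rel_Comp_Eq extensional_unary) (simp_all add: extensional_Eq_pred[of "[]"])

lemma Conv_Conv: "extensional P \<Longrightarrow> Conv (Conv P) = P"
  by (intro extensional_eqI extensional_Conv) (simp_all add: Rel_Conv unary_Conv extensional_unary)

lemma Comp_disj: "Comp (\<lambda>w. P w \<or> Q w) R = (\<lambda>w. Comp P R w \<or> Comp Q R w)"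
  unfolding Comp_def splits_def At_disj by blast

lemma Conv_disj: "Conv (\<lambda>w. P w \<or> Q w) = (\<lambda>w. Conv P w \<or> Conv Q w)"
  unfolding Conv_def At_disj by blast

text \<open>Once all elements are terms of a single variable, the three premises become instances of
  \<open>Rel\<close> there and \<open>Rel_Comp_I\<close> applies twice.\<close>

lemma Comp_assoc_le:
  assumes P: "unary P" and Q: "unary Q" and S: "unary S"
    and h: "Rel (Comp (Comp P Q) S) u i k w"
  shows "Rel (Comp P (Comp Q S)) u i k w"
proof -
  define b where "b = third u u"
  define c where "c = third u b"
  have n: "b \<noteq> u" "c \<noteq> u" "c \<noteq> b" "u \<noteq> b" "u \<noteq> c" "b \<noteq> c"
    using third_neq unfolding b_def c_def by metis+
  note PQ = unary_Comp[OF P Q] and QS = unary_Comp[OF Q S]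
  note PQS = unary_Comp[OF P QS]
  obtain w1 where w1: "ag b w w1" "At (Comp P Q) b [False] w1" "At S b [True] w1"
    "eqt w1 u i b [False, False]" "eqt w1 b [False, True] b [True, False]" "eqt w1 b [True, True] u k"
    using Rel_Comp_E[OF PQ S h n(1)] by blast
  have "Comp_at P Q b [False] w1" using At_Comp[OF P Q] w1(2) by simp
  then obtain w2 where w2: "ag c w1 w2" "splits P Q c b [False] w2" using Comp_at_get[OF P Q _ n(3)] by blast
  then have s: "At P c [False] w2" "At Q c [True] w2" "eqt w2 b [False, False] c [False, False]"
    "eqt w2 c [False, True] c [True, False]" "eqt w2 c [True, True] b [False, True]"
    unfolding splits_def by auto
  have b2: "At S b [True] w2" "eqt w2 b [False, True] b [True, False]" "eqt w2 b [True, True] b [True, True]"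
    using At_inv[OF S w1(3) w2(1) n(3)] eqt_inv[OF w1(5) w2(1) n(3,3)]
      eqt_inv[OF eqt_refl[OF w1(6)] w2(1) n(3,3)] by blast+
  have W2: "w2 \<in> W" using w2 ag_in by blast
  \<comment> \<open>\<open>u\<close> becomes the pair of \<open>c\<close> and \<open>b\<close>. Its
    old terms \<open>u_i\<close>, \<open>u_k\<close> are not lost, being equal to
    \<open>b_00\<close> and \<open>b_11\<close>. The components of \<open>c_0\<close>,
    \<open>c_1\<close>, \<open>b_1\<close> now have indices of length 3.\<close>
  obtain w3 where w3: "ag u w2 w3" "eqt w3 u [False] c []" "eqt w3 u [True] b []"
    using eqt_pair[OF eqt_refl_Nil[OF W2] eqt_refl_Nil[OF W2] n(5,4)] by blast
  have c3: "At P c [False] w3" "At Q c [True] w3" "At S b [True] w3"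
    using At_inv[OF P s(1) w3(1) n(5)] At_inv[OF Q s(2) w3(1) n(5)] At_inv[OF S b2(1) w3(1) n(4)] by blast+
  have e3: "eqt w3 b [False, False] c [False, False]"
    "eqt w3 c [False, True] c [True, False]" "eqt w3 c [True, True] b [False, True]"
    "eqt w3 b [False, True] b [True, False]" "eqt w3 b [True, True] b [True, True]"
    using eqt_inv[OF s(3) w3(1) n(4,5)] eqt_inv[OF s(4) w3(1) n(5,5)] eqt_inv[OF s(5) w3(1) n(5,4)]
      eqt_inv[OF b2(2) w3(1) n(4,4)] eqt_inv[OF b2(3) w3(1) n(4,4)] by blast+
  have uc: "eqt w3 u (False # l) r m" if "eqt w3 c l r m" "length l \<le> 2" for l r m
    using eqt_append[OF eqt_sym[OF w3(2)], of l r m] that by simp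
  have ub: "eqt w3 u (True # l) r m" if "eqt w3 b l r m" "length l \<le> 2" for l r m
    using eqt_append[OF eqt_sym[OF w3(3)], of l r m] that by simp
  have u0: "eqt w3 u [False, False, False] b [False, False]" using uc[OF eqt_sym[OF e3(1)]] by simp
  have u1: "eqt w3 u [False, True, False] u [False, False, True]"
    using uc[OF eqt_sym[OF uc[OF e3(2)]]] by simp
  have u2: "eqt w3 u [True, True, False] u [False, True, True]"
    using ub[OF eqt_sym[OF uc[OF eqt_trans[OF e3(3,4)]]]] by simp
  have u3: "eqt w3 u [True, True, True] b [True, True]" using ub[OF e3(5)] by simp
  have a3: "At P u [False, False] w3" "At Q u [False, True] w3" "At S u [True, True] w3"
    using At_ext[OF P eqt_sym[OF uc[OF At_refl[OF c3(1)]]] c3(1)]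
      At_ext[OF Q eqt_sym[OF uc[OF At_refl[OF c3(2)]]] c3(2)]
      At_ext[OF S eqt_sym[OF ub[OF At_refl[OF c3(3)]]] c3(3)] by auto
  have BP: "Rel P u [False, False, False] [False, False, True] w3"
    using Rel_At[OF P a3(1)] eqt_refl[OF u0] eqt_refl'[OF u1] by simp
  have BQ: "Rel Q u [False, True, False] [False, True, True] w3"
    using Rel_At[OF Q a3(2)] eqt_refl[OF u1] eqt_refl'[OF u2] by simp
  have BS: "Rel S u [True, True, False] [True, True, True] w3"
    using Rel_At[OF S a3(3)] eqt_refl[OF u2] eqt_refl[OF u3] by simp
  have "Rel S u [False, True, True] [True, True, True] w3"
    by (rule Rel_ext[OF S BS u2 eqt_refl[OF u3]])
  then have "Rel (Comp Q S) u [False, True, False] [True, True, True] w3"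
    by (rule Rel_Comp_I[OF Q S BQ])
  then have "Rel (Comp Q S) u [False, False, True] [True, True, True] w3"
    by (rule Rel_ext[OF QS _ u1 eqt_refl[OF u3]])
  then have "Rel (Comp P (Comp Q S)) u [False, False, False] [True, True, True] w3"
    by (rule Rel_Comp_I[OF P QS BP])
  then have "Rel (Comp P (Comp Q S)) b [False, False] [True, True] w3"
    by (rule Rel_ext[OF PQS _ u0 u3])
  then have "Rel (Comp P (Comp Q S)) b [False, False] [True, True] w1"
    by (intro Rel_inv[OF PQS Rel_inv[OF PQS _ ag_sym[OF w3(1)] n(4)] ag_sym[OF w2(1)] n(3)])
  then have "Rel (Comp P (Comp Q S)) u i k w1"
    by (rule Rel_ext[OF PQS _ eqt_sym[OF w1(4)] w1(6)])
  then show ?thesis by (rule Rel_inv[OF PQS _ ag_sym[OF w1(1)] n(1)])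
qed

lemma Rel_Conv_Comp:
  assumes P: "unary P" and Q: "unary Q"
  shows "Rel (Conv (Comp P Q)) u i k w \<longleftrightarrow> Rel (Comp (Conv Q) (Conv P)) u i k w"
proof -
  let ?b = "third u u"
  have n: "?b \<noteq> u" using third_neq by metis
  note PQ = unary_Comp[OF P Q]
  note QP = unary_Comp[OF unary_Conv[OF Q] unary_Conv[OF P]]
  have "Rel (Comp (Conv Q) (Conv P)) u i k w" if h: "Rel (Comp P Q) u k i w"
  proof -
    obtain w' where w': "ag ?b w w'" "At P ?b [False] w'" "At Q ?b [True] w'"
      "eqt w' u k ?b [False, False]" "eqt w' ?b [False, True] ?b [True, False]" "eqt w' ?b [True, True] u i"
      using Rel_Comp_E[OF P Q h n] by blast
    have "Rel P ?b [False, False] [False, True] w'" "Rel Q ?b [True, False] [True, True] w'"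
      using Rel_At[OF P w'(2)] Rel_At[OF Q w'(3)] eqt_refl[OF w'(5)] eqt_refl[OF w'(6)] eqt_refl'[OF w'(4)]
        eqt_refl'[OF w'(5)] by auto
    then have "Rel (Conv P) ?b [False, True] [False, False] w'" "Rel (Conv Q) ?b [True, True] [True, False] w'"
      using Rel_Conv[OF P] Rel_Conv[OF Q] by blast+
    then have "Rel (Comp (Conv Q) (Conv P)) ?b [True, True] [False, False] w'"
      using Rel_ext[OF unary_Conv[OF P] _ w'(5) eqt_refl'[OF w'(4)]]
        Rel_Comp_I[OF unary_Conv[OF Q] unary_Conv[OF P]] by blast
    then have "Rel (Comp (Conv Q) (Conv P)) u i k w'" by (rule Rel_ext[OF QP _ w'(6) eqt_sym[OF w'(4)]])
    then show ?thesis by (rule Rel_inv[OF QP _ ag_sym[OF w'(1)] n])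
  qed
  moreover have "Rel (Comp P Q) u k i w" if h: "Rel (Comp (Conv Q) (Conv P)) u i k w"
  proof -
    obtain w' where w': "ag ?b w w'" "At (Conv Q) ?b [False] w'" "At (Conv P) ?b [True] w'"
      "eqt w' u i ?b [False, False]" "eqt w' ?b [False, True] ?b [True, False]" "eqt w' ?b [True, True] u k"
      using Rel_Comp_E[OF unary_Conv[OF Q] unary_Conv[OF P] h n] by blast
    have "Rel Q ?b [False, True] [False, False] w'" "Rel P ?b [True, True] [True, False] w'"
      using At_Conv[OF Q, of "[False]"] At_Conv[OF P, of "[True]"] w'(2,3) by auto
    then have "Rel (Comp P Q) ?b [True, True] [False, False] w'"
      using Rel_ext[OF Q _ w'(5) eqt_refl'[OF w'(4)]] Rel_Comp_I[OF P Q] by blast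
    then have "Rel (Comp P Q) u k i w'" by (rule Rel_ext[OF PQ _ w'(6) eqt_sym[OF w'(4)]])
    then show ?thesis by (rule Rel_inv[OF PQ _ ag_sym[OF w'(1)] n])
  qed
  ultimately show ?thesis using Rel_Conv[OF PQ] by blast
qed

lemma Conv_Comp: "unary P \<Longrightarrow> unary Q \<Longrightarrow> Conv (Comp P Q) = Comp (Conv Q) (Conv P)"
  by (intro extensional_eqI extensional_Conv extensional_Comp unary_Comp unary_Conv Rel_Conv_Comp)

text \<open>The reverse inclusion is \<open>Comp_assoc_le\<close> for the converses in reverse
  order, translated back by \<open>Conv_Comp\<close>.\<close>

lemma Comp_assoc:
  assumes P: "extensional P" and Q: "extensional Q" and S: "extensional S"
  shows "Comp (Comp P Q) S = Comp P (Comp Q S)"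
proof (rule extensional_eqI)
  note p = extensional_unary[OF P] and q = extensional_unary[OF Q] and s = extensional_unary[OF S]
  note p' = unary_Conv[OF p] and q' = unary_Conv[OF q] and s' = unary_Conv[OF s]
  show "extensional (Comp (Comp P Q) S)" "extensional (Comp P (Comp Q S))"
    using extensional_Comp unary_Comp p q s by blast+
  fix w
  have conv: "Comp (Comp (Conv S) (Conv Q)) (Conv P) = Conv (Comp P (Comp Q S))"
    "Comp (Conv S) (Comp (Conv Q) (Conv P)) = Conv (Comp (Comp P Q) S)"
    using Conv_Comp p q s unary_Comp by simp_all
  show "Rel (Comp (Comp P Q) S) VX [False] [True] w \<longleftrightarrow> Rel (Comp P (Comp Q S)) VX [False] [True] w"
    using Comp_assoc_le[OF p q s, of VX "[False]" "[True]" w]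
      Comp_assoc_le[OF s' q' p', of VX "[True]" "[False]" w, unfolded conv]
      Rel_Conv[OF unary_Comp[OF p unary_Comp[OF q s]]] Rel_Conv[OF unary_Comp[OF unary_Comp[OF p q] s]]
    by blast
qed

text \<open>If \<open>x\<close> were in \<open>Q\<close>, then \<open>P\<close> would lead from
  \<open>y_01\<close> to \<open>y_00\<close>, which equals \<open>x_0\<close>, and \<open>Q\<close>
  from there to \<open>x_1\<close>, which equals \<open>y_11\<close>. As \<open>y_01\<close> equals
  \<open>y_10\<close>, the pair \<open>y_1\<close> would lie in the composition it was chosen to
  avoid.\<close>

lemma Comp_Conv_Compl_le:
  assumes P: "extensional P" and Q: "extensional Q" and h: "Comp (Conv P) (Compl (Comp P Q)) w"
  shows "Compl Q w"
proof -
  note p = extensional_unary[OF P] and q = extensional_unary[OF Q]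
  note p' = unary_Conv[OF p] and r' = unary_Compl[OF extensional_Comp[OF p q]]
  have "Rel (Comp (Conv P) (Compl (Comp P Q))) VX [False] [True] w"
    using h extensional_Rel[OF extensional_Comp[OF p' r']] by simp
  then obtain w1 where w1: "ag VY w w1" "At (Conv P) VY [False] w1" "At (Compl (Comp P Q)) VY [True] w1"
    "eqt w1 VX [False] VY [False, False]" "eqt w1 VY [False, True] VY [True, False]"
    "eqt w1 VY [True, True] VX [True]"
    using Rel_Comp_E[OF p' r', of VX "[False]" "[True]" w VY] by auto
  have False if "Rel Q VX [False] [True] w"
  proof -
    have W1: "w1 \<in> W" using w1 ag_in by blast
    \<comment> \<open>\<open>z\<close> is the pair of \<open>x\<close> and \<open>y\<close>, so that
      facts about both become facts about terms of \<open>z\<close>, as \<open>Rel_Comp_I\<close>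
      requires.\<close>
    obtain w2 where w2: "ag VZ w1 w2" "eqt w2 VZ [False] VX []" "eqt w2 VZ [True] VY []"
      using eqt_pair[OF eqt_refl_Nil[OF W1] eqt_refl_Nil[OF W1], of VZ VX VY] by auto
    have e: "eqt w2 VX [False] VY [False, False]" "eqt w2 VY [False, True] VY [True, False]"
      "eqt w2 VY [True, True] VX [True]"
      using eqt_inv[OF w1(4) w2(1)] eqt_inv[OF w1(5) w2(1)] eqt_inv[OF w1(6) w2(1)] by auto
    have zx: "eqt w2 VZ (False # l) r m" if "eqt w2 VX l r m" "length l \<le> 2" for l r m
      using eqt_append[OF eqt_sym[OF w2(2)], of l r m] that by simp
    have zy: "eqt w2 VZ (True # l) r m" if "eqt w2 VY l r m" "length l \<le> 2" for l r m
      using eqt_append[OF eqt_sym[OF w2(3)], of l r m] that by simp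
    have z: "eqt w2 VZ [True, False, False] VZ [False, False]" "eqt w2 VZ [True, True, False] VZ [True, False, True]"
      "eqt w2 VZ [False, True] VZ [True, True, True]"
      using zy[OF eqt_sym[OF zx[OF e(1)]]] zy[OF eqt_sym[OF zy[OF e(2)]]] zx[OF eqt_sym[OF zy[OF e(3)]]] by auto
    have "At (Conv P) VY [False] w2" using At_inv[OF p' w1(2) w2(1)] by simp
    then have "At (Conv P) VZ [True, False] w2"
      using At_ext[OF p' eqt_sym[OF zy[OF At_refl]]] by simp
    then have "Rel P VZ [True, False, True] [True, False, False] w2" using At_Conv[OF p] by simp
    then have BP: "Rel P VZ [True, False, True] [False, False] w2"
      by (rule Rel_ext[OF p _ eqt_refl'[OF z(2)] z(1)])
    have "At Q VX [] w" using that extensional_At[OF Q, of "[]"] by simp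
    then have "At Q VX [] w2" using At_inv[OF q At_inv[OF q _ w1(1)] w2(1)] by simp
    then have "At Q VZ [False] w2" using At_ext[OF q eqt_sym[OF w2(2)]] by simp
    then have BQ: "Rel Q VZ [False, False] [False, True] w2" using extensional_At[OF Q] by simp
    have "Rel (Comp P Q) VZ [True, True, False] [True, True, True] w2"
      by (rule Rel_ext[OF unary_Comp[OF p q] Rel_Comp_I[OF p q BP BQ] eqt_sym[OF z(2)] z(3)])
    moreover have "At (Compl (Comp P Q)) VY [True] w2" using At_inv[OF r' w1(3) w2(1)] by simp
    then have "At (Compl (Comp P Q)) VZ [True, True] w2"
      using At_ext[OF r' eqt_sym[OF zy[OF At_refl]]] by simp
    then have "\<not> Rel (Comp P Q) VZ [True, True, False] [True, True, True] w2"
      using At_Compl[OF extensional_Comp[OF p q]] by simp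
    ultimately show False by blast
  qed
  moreover have "eqt w VX [False] VX [False]" "eqt w VX [True] VX [True]"
    using eqt_inv[OF eqt_refl[OF w1(4)] ag_sym[OF w1(1)]] eqt_inv[OF eqt_refl'[OF w1(6)] ag_sym[OF w1(1)]] by auto
  ultimately show ?thesis using extensional_Rel[OF Q] by (auto simp: Compl_def)
qed

section \<open>Quasi-projections\<close>

text \<open>The graph of the partial function \<open>p_k\<close>, the argument being the first
  component of \<open>x\<close> and the value the second.\<close>

definition Proj :: "bool \<Rightarrow> 'w \<Rightarrow> bool" where
  "Proj k = Eq_pred [False, k] [True]"

lemma extensional_Proj: "extensional (Proj k)"
  using extensional_Eq_pred[of "[k]"] by (simp add: Proj_def)

lemma Rel_Proj: "length i \<le> 2 \<Longrightarrow> Rel (Proj k) u i j w \<longleftrightarrow> eqt w u (i @ [k]) u j"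
  using Rel_Eq_pred[of "[k]" i u j w] eqt_prefix[of w u i k u j] by (auto simp: Proj_def)

text \<open>Projections are functional: both end points of the witness are the
  \<open>k\<close>-component of its middle element.\<close>

lemma Comp_Conv_Proj_le:
  assumes "Comp (Conv (Proj k)) (Proj k) w"
  shows "Eq_pred [False] [True] w"
proof -
  note p = extensional_unary[OF extensional_Proj[of k]]
  note p' = unary_Conv[OF p]
  have "Rel (Comp (Conv (Proj k)) (Proj k)) VX [False] [True] w"
    using assms extensional_Rel[OF extensional_Comp[OF p' p]] by simp
  then obtain w1 where w1: "ag VY w w1" "At (Conv (Proj k)) VY [False] w1" "At (Proj k) VY [True] w1"
    "eqt w1 VX [False] VY [False, False]" "eqt w1 VY [False, True] VY [True, False]"
    "eqt w1 VY [True, True] VX [True]"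
    using Rel_Comp_E[OF p' p, of VX "[False]" "[True]" w VY] by auto
  have e0: "eqt w1 VY [False, True, k] VY [False, False]" using w1(2) At_Conv[OF p] Rel_Proj by simp
  have e1: "eqt w1 VY [True, False, k] VY [True, True]" using w1(3) extensional_At[OF extensional_Proj] Rel_Proj by simp
  have "eqt w1 VY [True, False, k] VY [False, False]" using eqt_children(4)[OF w1(5) e0] .
  then have "eqt w1 VY [False, False] VY [True, True]" using eqt_trans[OF eqt_sym e1] by blast
  then have "eqt w1 VX [False] VX [True]" using eqt_trans[OF w1(4) eqt_trans[OF _ w1(6)]] by blast
  then show ?thesis using eqt_inv[OF _ ag_sym[OF w1(1)]] by (simp add: Eq_pred_def)
qed

text \<open>By (A3) some \<open>y\<close> has the two components of \<open>x\<close>; this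
  \<open>y\<close> is the middle element.\<close>

lemma Comp_Conv_Proj_total:
  assumes "eqt w VX [False] VX [False]" "eqt w VX [True] VX [True]"
  shows "Comp (Conv (Proj False)) (Proj True) w"
proof -
  note p = extensional_unary[OF extensional_Proj[of False]] and q = extensional_unary[OF extensional_Proj[of True]]
  note p' = unary_Conv[OF p]
  obtain w1 where w1: "ag VY w w1" "eqt w1 VY [False] VX [False]" "eqt w1 VY [True] VX [True]"
    using eqt_pair[OF assms, of VY] by auto
  have "Rel (Proj False) VY [] [False] w1" "Rel (Proj True) VY [] [True] w1"
    using Rel_Proj eqt_refl[OF w1(2)] eqt_refl[OF w1(3)] by simp_all
  then have "Rel (Comp (Conv (Proj False)) (Proj True)) VY [False] [True] w1"
    using Rel_Comp_I[OF p' q] Rel_Conv[OF p] by blast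
  then have "Rel (Comp (Conv (Proj False)) (Proj True)) VX [False] [True] w1"
    using Rel_ext[OF unary_Comp[OF p' q] _ w1(2,3)] by blast
  then have "Rel (Comp (Conv (Proj False)) (Proj True)) VX [False] [True] w"
    using Rel_inv[OF unary_Comp[OF p' q] _ ag_sym[OF w1(1)]] by simp
  then show ?thesis using extensional_Rel[OF extensional_Comp[OF p' q]] by simp
qed

end

section \<open>The algebra of formulas\<close>

lemma ra_quotient_ops:
  assumes cong: "ra_congruence A R" and a: "a \<in> carr A"
  shows "b \<in> carr A \<Longrightarrow> join (ra_quotient A R) (R `` {a}) (R `` {b}) = R `` {join A a b}"
    and "b \<in> carr A \<Longrightarrow> rcomp (ra_quotient A R) (R `` {a}) (R `` {b}) = R `` {rcomp A a b}"
    and "cmpl (ra_quotient A R) (R `` {a}) = R `` {cmpl A a}"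
    and "conv (ra_quotient A R) (R `` {a}) = R `` {conv A a}"
proof -
  have eq: "equiv (carr A) R" using cong by (simp add: ra_congruence_def)
  note cls = equiv_class_eq[OF eq]
  have "(\<lambda>a b. R `` {join A a b}) respects2 R" "(\<lambda>a b. R `` {rcomp A a b}) respects2 R"
    "(\<lambda>a. R `` {cmpl A a}) respects R" "(\<lambda>a. R `` {conv A a}) respects R"
    using cong unfolding ra_congruence_def congruent2_def congruent_def by (fastforce intro!: cls)+
  note r = this
  show "join (ra_quotient A R) (R `` {a}) (R `` {b}) = R `` {join A a b}" if "b \<in> carr A"
    using UN_equiv_class2[OF eq eq r(1) a that] by (simp add: ra_quotient_def)
  show "rcomp (ra_quotient A R) (R `` {a}) (R `` {b}) = R `` {rcomp A a b}" if "b \<in> carr A"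
    using UN_equiv_class2[OF eq eq r(2) a that] by (simp add: ra_quotient_def)
  show "cmpl (ra_quotient A R) (R `` {a}) = R `` {cmpl A a}"
    using UN_equiv_class[OF eq r(3) a] by (simp add: ra_quotient_def)
  show "conv (ra_quotient A R) (R `` {a}) = R `` {conv A a}"
    using UN_equiv_class[OF eq r(4) a] by (simp add: ra_quotient_def)
qed

locale complete_ax_model = ax_model W ag sat \<Delta>
  for W :: "'w set" and ag and sat :: "'w \<Rightarrow> fmd3 \<Rightarrow> bool"  (infix "\<Turnstile>" 45) and \<Delta> +
  assumes complete: "{Ax \<Delta>} \<turnstile> \<phi> \<longleftrightarrow> (\<forall>w\<in>W. w \<Turnstile> \<phi>)"
begin

section \<open>Formulas as sets of worlds\<close>

definition sem :: "fmd3 \<Rightarrow> 'w \<Rightarrow> bool" where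
  "sem \<phi> w \<longleftrightarrow> w \<in> W \<and> w \<Turnstile> \<phi>"

lemma prov_Iff_sem: "{Ax \<Delta>} \<turnstile> \<phi> \<^bold>\<longleftrightarrow> \<psi> \<longleftrightarrow> sem \<phi> = sem \<psi>"
  by (auto simp: complete sat_Iff sem_def fun_eq_iff)

lemma unary_sem:
  assumes "\<phi> \<in> Fmd1" shows "unary (sem \<phi>)"
  unfolding unary_def sem_def using sat_fv[of _ \<phi>] ag_in assms unfolding Fmd1_def by blast

lemma sem_plus: "sem (plus_fm \<phi> \<psi>) = (\<lambda>w. sem \<phi> w \<or> sem \<psi> w)"
  by (auto simp: plus_fm_def sem_def sat_Or fun_eq_iff)

lemma sem_And: "sem (\<phi> \<^bold>\<and> \<psi>) w \<longleftrightarrow> sem \<phi> w \<and> sem \<psi> w"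
  by (auto simp: sem_def sat_And)

lemma sem_Ex: "sem (Ex v \<phi>) w \<longleftrightarrow> (\<exists>w'. ag v w w' \<and> sem \<phi> w')"
  unfolding sem_def using ag_in sat_Ex by blast

lemma sem_eqt: "length i \<le> 3 \<Longrightarrow> length j \<le> 3 \<Longrightarrow> sem (doteq \<Delta> u i v j) w \<longleftrightarrow> eqt w u i v j"
  by (simp add: sem_def eqt_def)

lemma sem_at_term: "length i \<le> 3 \<Longrightarrow> sem (at_term \<Delta> \<phi> VY i) w \<longleftrightarrow> At (sem \<phi>) VY i w"
  by (simp add: at_term_def At_neq sem_Ex sem_And sem_eqt)

lemma sem_comp: "sem (comp_fm \<Delta> \<phi> \<psi>) = Comp (sem \<phi>) (sem \<psi>)"
  by (simp add: fun_eq_iff comp_fm_def Comp_def splits_def sem_Ex sem_And sem_at_term sem_eqt)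

lemma sem_conv: "sem (conv_fm \<Delta> \<phi>) = Conv (sem \<phi>)"
  by (simp add: fun_eq_iff conv_fm_def Conv_def sem_Ex sem_And sem_at_term sem_eqt)

lemma sem_doteq: "length i \<le> 3 \<Longrightarrow> length j \<le> 3 \<Longrightarrow> sem (doteq \<Delta> VX i VX j) = Eq_pred i j"
  by (auto simp: sem_def Eq_pred_def eqt_def fun_eq_iff)

lemma sem_id: "sem (id_fm \<Delta>) = Eq_pred [False] [True]"
  by (simp add: id_fm_def sem_doteq)

lemma sem_proj: "sem (doteq \<Delta> VX [True] VX [False, k]) = Proj k"
  by (auto simp: sem_doteq Proj_def Eq_pred_def fun_eq_iff dest: eqt_sym)

text \<open>The simulated substitution for \<open>x\<close>, \<open>y\<close> is the identity, so
  \<open>proj \<Delta> k\<close> is literally the equation between \<open>x_k\<close> and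
  \<open>y\<close>.\<close>

lemma sem_Ex_proj: "sem (Ex VY (proj \<Delta> k)) w \<longleftrightarrow> eqt w VX [k] VX [k]"
proof -
  have "sem (proj \<Delta> k) w' \<longleftrightarrow> eqt w' VX [k] VY []" for w'
    by (simp add: sem_def eqt_def doteq_def doteq_dist_def)
  then have "sem (Ex VY (proj \<Delta> k)) w \<longleftrightarrow> (\<exists>w'. ag VY w w' \<and> eqt w' VX [k] VY [])"
    by (simp add: sem_Ex)
  also have "\<dots> \<longleftrightarrow> eqt w VX [k] VX [k]"
  proof
    assume "eqt w VX [k] VX [k]"
    then show "\<exists>w'. ag VY w w' \<and> eqt w' VX [k] VY []"
      using eqt_copy[of w VX "[k]" VY] by (auto dest: eqt_sym)
  next
    assume "\<exists>w'. ag VY w w' \<and> eqt w' VX [k] VY []"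
    then obtain w' where "ag VY w w'" "eqt w' VX [k] VY []" by blast
    then show "eqt w VX [k] VX [k]" using eqt_inv[OF eqt_refl ag_sym] by simp
  qed
  finally show ?thesis .
qed

lemma sem_compl: "sem (compl_fm \<Delta> \<phi>) = Compl (sem \<phi>)"
proof
  fix w
  have "sem (pair_fm \<Delta>) w \<longleftrightarrow> eqt w VX [False] VX [False] \<and> eqt w VX [True] VX [True]"
    using sem_Ex_proj[of False w] sem_Ex_proj[of True w] by (simp add: pair_fm_def sem_And proj_def)
  moreover have "w \<in> W \<Longrightarrow> sem (\<^bold>\<not> \<phi>) w \<longleftrightarrow> \<not> sem \<phi> w" by (simp add: sem_def sat_Neg)
  ultimately show "sem (compl_fm \<Delta> \<phi>) w = Compl (sem \<phi>) w"
    unfolding compl_fm_def sem_And Compl_def by (auto simp: eqt_def sem_def)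
qed

text \<open>Composing with the identity makes any unary predicate extensional and leaves an
  extensional one unchanged (\<open>Comp_Eq\<close>). A member of \<open>Dra\<close> may have
  further free variables, hence the detour through an equivalent \<open>\<psi>\<close>.\<close>

lemma Dra_iff: "\<phi> \<in> Dra \<Delta> \<longleftrightarrow> (\<exists>\<psi>\<in>Fmd1. extensional (sem \<psi>) \<and> sem \<phi> = sem \<psi>)"
proof
  have id: "id_fm \<Delta> \<in> Fmd1" by (simp add: id_fm_def fv_doteq_Fmd1)
  {
    assume "\<phi> \<in> Dra \<Delta>"
    then obtain \<psi> where \<psi>: "\<psi> \<in> Fmd1" "sem \<phi> = sem (comp_fm \<Delta> \<psi> (id_fm \<Delta>))"
      by (auto simp: Dra_def prov_Iff_sem)
    have "extensional (sem (comp_fm \<Delta> \<psi> (id_fm \<Delta>)))" using extensional_Comp unary_sem \<psi>(1) id by (simp add: sem_comp)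
    then show "\<exists>\<psi>\<in>Fmd1. extensional (sem \<psi>) \<and> sem \<phi> = sem \<psi>" using \<psi> fv_comp_fm id by blast
  next
    assume "\<exists>\<psi>\<in>Fmd1. extensional (sem \<psi>) \<and> sem \<phi> = sem \<psi>"
    then obtain \<psi> where "\<psi> \<in> Fmd1" "extensional (sem \<psi>)" "sem \<phi> = sem \<psi>" by blast
    then show "\<phi> \<in> Dra \<Delta>"
      by (auto simp: Dra_def prov_Iff_sem sem_comp sem_id Comp_Eq intro!: bexI[of _ \<psi>])
  }
qed

lemma Dra_good: "\<phi> \<in> Dra \<Delta> \<Longrightarrow> extensional (sem \<phi>)"
  by (auto simp: Dra_iff)

lemma Dra_I: "\<phi> \<in> Fmd1 \<Longrightarrow> extensional (sem \<phi>) \<Longrightarrow> \<phi> \<in> Dra \<Delta>"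
  by (auto simp: Dra_iff)

lemma Dra_plus: "\<phi> \<in> Dra \<Delta> \<Longrightarrow> \<psi> \<in> Dra \<Delta> \<Longrightarrow> plus_fm \<phi> \<psi> \<in> Dra \<Delta>"
proof -
  assume "\<phi> \<in> Dra \<Delta>" "\<psi> \<in> Dra \<Delta>"
  then obtain \<phi>' \<psi>' where h: "\<phi>' \<in> Fmd1" "extensional (sem \<phi>')" "sem \<phi> = sem \<phi>'"
    "\<psi>' \<in> Fmd1" "extensional (sem \<psi>')" "sem \<psi> = sem \<psi>'" by (auto simp: Dra_iff)
  then have "plus_fm \<phi>' \<psi>' \<in> Fmd1" by (simp add: Fmd1_def plus_fm_def)
  moreover have "extensional (sem (plus_fm \<phi>' \<psi>'))" using h extensional_disj by (simp add: sem_plus)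
  moreover have "sem (plus_fm \<phi> \<psi>) = sem (plus_fm \<phi>' \<psi>')" using h by (simp add: sem_plus)
  ultimately show ?thesis unfolding Dra_iff by blast
qed

lemma Dra_compl: "\<phi> \<in> Dra \<Delta> \<Longrightarrow> compl_fm \<Delta> \<phi> \<in> Dra \<Delta>"
  by (metis Dra_iff fv_compl_fm extensional_Compl sem_compl)

lemma Fmd1_comp_in_Dra: "\<phi> \<in> Fmd1 \<Longrightarrow> \<psi> \<in> Fmd1 \<Longrightarrow> comp_fm \<Delta> \<phi> \<psi> \<in> Dra \<Delta>"
  by (simp add: Dra_I fv_comp_fm sem_comp extensional_Comp unary_sem)

lemma Dra_comp: "\<phi> \<in> Dra \<Delta> \<Longrightarrow> \<psi> \<in> Dra \<Delta> \<Longrightarrow> comp_fm \<Delta> \<phi> \<psi> \<in> Dra \<Delta>"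
proof -
  assume "\<phi> \<in> Dra \<Delta>" "\<psi> \<in> Dra \<Delta>"
  then obtain \<phi>' \<psi>' where h: "\<phi>' \<in> Fmd1" "sem \<phi> = sem \<phi>'" "\<psi>' \<in> Fmd1" "sem \<psi> = sem \<psi>'"
    by (auto simp: Dra_iff)
  then have "sem (comp_fm \<Delta> \<phi> \<psi>) = sem (comp_fm \<Delta> \<phi>' \<psi>')" by (simp add: sem_comp)
  then show ?thesis using Fmd1_comp_in_Dra[OF h(1,3)] by (simp add: Dra_iff)
qed

lemma Dra_conv: "\<phi> \<in> Dra \<Delta> \<Longrightarrow> conv_fm \<Delta> \<phi> \<in> Dra \<Delta>"
  by (metis Dra_iff fv_conv_fm extensional_Conv extensional_unary sem_conv)

lemma Dra_id: "id_fm \<Delta> \<in> Dra \<Delta>"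
  using extensional_Eq_pred[of "[]"] sem_id fv_doteq_Fmd1 by (auto intro!: Dra_I simp: id_fm_def)

lemma Dra_proj: "doteq \<Delta> VX [True] VX [False, k] \<in> Dra \<Delta>"
  by (simp add: Dra_I fv_doteq_Fmd1 sem_proj extensional_Proj)

section \<open>The quotient algebra\<close>

lemma Dra_eq_iff: "(\<phi>, \<psi>) \<in> Dra_eq \<Delta> \<longleftrightarrow> \<phi> \<in> Dra \<Delta> \<and> \<psi> \<in> Dra \<Delta> \<and> sem \<phi> = sem \<psi>"
  by (auto simp: Dra_eq_def prov_eq_def prov_Iff_sem)

lemma equiv_Dra_eq: "equiv (Dra \<Delta>) (Dra_eq \<Delta>)"
  by (rule equivI) (auto simp: Dra_eq_iff intro!: refl_onI symI transI)

lemma ra_congruence_Dra: "ra_congruence (Dra_alg \<Delta>) (Dra_eq \<Delta>)"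
  unfolding ra_congruence_def Dra_alg_def using equiv_Dra_eq
  by (auto simp: Dra_eq_iff Dra_plus Dra_compl Dra_comp Dra_conv sem_plus sem_compl sem_comp sem_conv)

abbreviation "QA \<equiv> ra_quotient (Dra_alg \<Delta>) (Dra_eq \<Delta>)"

definition cls :: "fmd3 \<Rightarrow> fmd3 set" where
  "cls \<phi> = Dra_eq \<Delta> `` {\<phi>}"

lemma cls_eq_iff: "\<phi> \<in> Dra \<Delta> \<Longrightarrow> \<psi> \<in> Dra \<Delta> \<Longrightarrow> cls \<phi> = cls \<psi> \<longleftrightarrow> sem \<phi> = sem \<psi>"
  using eq_equiv_class_iff[OF equiv_Dra_eq] by (simp add: cls_def Dra_eq_iff)

lemma carr_QA: "carr QA = cls ` Dra \<Delta>"
  by (auto simp: ra_quotient_def Dra_alg_def quotient_def cls_def)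

lemma QA_ops:
  assumes "\<phi> \<in> Dra \<Delta>"
  shows "\<psi> \<in> Dra \<Delta> \<Longrightarrow> join QA (cls \<phi>) (cls \<psi>) = cls (plus_fm \<phi> \<psi>)"
    and "\<psi> \<in> Dra \<Delta> \<Longrightarrow> rcomp QA (cls \<phi>) (cls \<psi>) = cls (comp_fm \<Delta> \<phi> \<psi>)"
    and "cmpl QA (cls \<phi>) = cls (compl_fm \<Delta> \<phi>)"
    and "conv QA (cls \<phi>) = cls (conv_fm \<Delta> \<phi>)"
  using ra_quotient_ops[OF ra_congruence_Dra, of \<phi>] assms by (simp_all add: Dra_alg_def cls_def)

lemma ident_QA: "ident QA = cls (id_fm \<Delta>)"
  by (simp add: ra_quotient_def Dra_alg_def cls_def)

text \<open>Members of \<open>Dra\<close> lie below \<open>pair_fm\<close>, the unit relative to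
  which \<open>compl_fm\<close> complements; the Boolean laws depend on this.\<close>

lemma Dra_pair:
  assumes "\<phi> \<in> Dra \<Delta>" "sem \<phi> w"
  shows "eqt w VX [False] VX [False]" "eqt w VX [True] VX [True]"
  using Rel_refl[of "sem \<phi>" VX "[False]" "[True]" w] extensional_Rel[OF Dra_good[OF assms(1)]] assms(2) by simp_all

text \<open>These rules turn a law about classes into an equation between predicates of
  worlds.\<close>

lemmas QA_simps = QA_ops ident_QA meet_def ra_le_def cls_eq_iff Dra_plus Dra_compl Dra_comp Dra_conv Dra_id
  sem_plus sem_compl sem_comp sem_conv sem_id

lemma relation_algebra_QA: "relation_algebra QA"
proof
  fix a b c
  {
    assume "a \<in> carr QA"
    then obtain \<phi> where a: "a = cls \<phi>" and \<phi>: "\<phi> \<in> Dra \<Delta>" by (auto simp: carr_QA)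
    note g = Dra_good[OF \<phi>] and pr = Dra_pair[OF \<phi>]
    show "cmpl QA a \<in> carr QA" "conv QA a \<in> carr QA"
      using \<phi> by (auto simp: a carr_QA QA_simps)
    show "rcomp QA a (ident QA) = a" using \<phi> g by (simp add: a QA_simps Comp_Eq)
    show "conv QA (conv QA a) = a" using \<phi> g by (simp add: a QA_simps Conv_Conv)
    assume "b \<in> carr QA"
    then obtain \<psi> where b: "b = cls \<psi>" and \<psi>: "\<psi> \<in> Dra \<Delta>" by (auto simp: carr_QA)
    note g' = Dra_good[OF \<psi>] and pr' = Dra_pair[OF \<psi>]
    note un = extensional_unary[OF g] extensional_unary[OF g']
    show "join QA a b \<in> carr QA" "rcomp QA a b \<in> carr QA"
      using \<phi> \<psi> by (auto simp: a b carr_QA QA_simps)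
    show "join QA a b = join QA b a" "meet QA a b = meet QA b a"
      using \<phi> \<psi> by (auto simp: a b QA_simps Compl_def)
    show "join QA a (meet QA a b) = a" "meet QA a (join QA a b) = a"
      "join QA a (cmpl QA a) = join QA b (cmpl QA b)" "meet QA a (cmpl QA a) = meet QA b (cmpl QA b)"
      using \<phi> \<psi> pr pr' by (auto simp: a b QA_simps Compl_def fun_eq_iff)
    show "conv QA (join QA a b) = join QA (conv QA a) (conv QA b)"
      using \<phi> \<psi> by (simp add: a b QA_simps Conv_disj)
    show "conv QA (rcomp QA a b) = rcomp QA (conv QA b) (conv QA a)"
      using \<phi> \<psi> by (simp add: a b QA_simps Conv_Comp un)
    show "ra_le QA (rcomp QA (conv QA a) (cmpl QA (rcomp QA a b))) (cmpl QA b)"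
      using \<phi> \<psi> Comp_Conv_Compl_le[OF g g'] by (auto simp: a b QA_simps)
    assume "c \<in> carr QA"
    then obtain \<chi> where c: "c = cls \<chi>" and \<chi>: "\<chi> \<in> Dra \<Delta>" by (auto simp: carr_QA)
    note g'' = Dra_good[OF \<chi>] and pr'' = Dra_pair[OF \<chi>]
    show "join QA (join QA a b) c = join QA a (join QA b c)"
      "meet QA (meet QA a b) c = meet QA a (meet QA b c)"
      "meet QA a (join QA b c) = join QA (meet QA a b) (meet QA a c)"
      using \<phi> \<psi> \<chi> pr pr' pr'' by (auto simp: a b c QA_simps Compl_def fun_eq_iff)
    show "rcomp QA (rcomp QA a b) c = rcomp QA a (rcomp QA b c)"
      using \<phi> \<psi> \<chi> Comp_assoc[OF g g' g''] by (simp add: a b c QA_simps)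
    show "rcomp QA (join QA a b) c = join QA (rcomp QA a c) (rcomp QA b c)"
      using \<phi> \<psi> \<chi> by (simp add: a b c QA_simps Comp_disj)
  }
  show "ident QA \<in> carr QA" by (auto simp: carr_QA QA_simps)
qed

lemma quasi_projection_pair_QA:
  "quasi_projection_pair QA (cls (doteq \<Delta> VX [True] VX [False, False])) (cls (doteq \<Delta> VX [True] VX [False, True]))"
proof -
  let ?p = "doteq \<Delta> VX [True] VX [False, False]" and ?q = "doteq \<Delta> VX [True] VX [False, True]"
  \<comment> \<open>The right-hand side is the top element, which holds exactly where both
    components of \<open>x\<close> are defined.\<close>
  have "Comp (Conv (Proj False)) (Proj True) w \<longleftrightarrow> Eq_pred [False] [True] w \<or> Compl (Eq_pred [False] [True]) w" for w
  proof
    assume "Comp (Conv (Proj False)) (Proj True) w"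
    then have "sem (comp_fm \<Delta> (conv_fm \<Delta> ?p) ?q) w" by (simp add: sem_comp sem_conv sem_proj)
    then have "eqt w VX [False] VX [False]" "eqt w VX [True] VX [True]"
      using Dra_pair[OF Dra_comp[OF Dra_conv[OF Dra_proj] Dra_proj]] by blast+
    then show "Eq_pred [False] [True] w \<or> Compl (Eq_pred [False] [True]) w" by (simp add: Compl_def)
  next
    assume "Eq_pred [False] [True] w \<or> Compl (Eq_pred [False] [True]) w"
    then show "Comp (Conv (Proj False)) (Proj True) w"
      using Comp_Conv_Proj_total eqt_refl eqt_refl' by (auto simp: Compl_def Eq_pred_def)
  qed
  then show ?thesis
    unfolding quasi_projection_pair_def
    using Comp_Conv_Proj_le by (auto simp: carr_QA QA_simps Dra_proj sem_proj fun_eq_iff)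
qed

end

theorem theorem3p7:
  fixes \<Delta> :: params
  assumes "fv (delta_xy \<Delta>) \<subseteq> {VX, VY}"
    and "fv (delta_xz \<Delta>) \<subseteq> {VX, VZ}"
    and "fv (proj0 \<Delta>) \<subseteq> {VX, VY}"
    and "fv (proj1 \<Delta>) \<subseteq> {VX, VY}"
  shows
    "((\<forall>\<phi>\<in>Dra \<Delta>. \<forall>\<psi>\<in>Dra \<Delta>. plus_fm \<phi> \<psi> \<in> Dra \<Delta>) \<and>
      (\<forall>\<phi>\<in>Dra \<Delta>. compl_fm \<Delta> \<phi> \<in> Dra \<Delta>) \<and>
      (\<forall>\<phi>\<in>Dra \<Delta>. \<forall>\<psi>\<in>Dra \<Delta>. comp_fm \<Delta> \<phi> \<psi> \<in> Dra \<Delta>) \<and>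
      (\<forall>\<phi>\<in>Dra \<Delta>. conv_fm \<Delta> \<phi> \<in> Dra \<Delta>) \<and>
      id_fm \<Delta> \<in> Dra \<Delta>) \<and>
     {comp_fm \<Delta> \<phi> \<psi> |\<phi> \<psi>. \<phi> \<in> Fmd1 \<and> \<psi> \<in> Fmd1} \<subseteq> Dra \<Delta> \<and>
     (ra_congruence (Dra_alg \<Delta>) (Dra_eq \<Delta>) \<and>
      relation_algebra (ra_quotient (Dra_alg \<Delta>) (Dra_eq \<Delta>))) \<and>
     quasi_projection_pair (ra_quotient (Dra_alg \<Delta>) (Dra_eq \<Delta>))
       (Dra_eq \<Delta> `` {doteq \<Delta> VX [True] VX [False, False]})
       (Dra_eq \<Delta> `` {doteq \<Delta> VX [True] VX [False, True]})"
proof -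
  let ?T = "{Ax \<Delta>}"
  interpret kripke "worlds ?T" "agree ?T" "\<lambda>G \<phi>. \<phi> \<in> G" by (rule canonical_kripke)
  interpret complete_ax_model "worlds ?T" "agree ?T" "\<lambda>G \<phi>. \<phi> \<in> G" \<Delta>
  proof unfold_locales
    show "Ax \<Delta> \<in> G" if "G \<in> worlds ?T" for G
      using prov_iff_worlds hyp that by blast
  qed (rule assms prov_iff_worlds)+
  show ?thesis
    using relation_algebra_QA quasi_projection_pair_QA
    by (auto simp: cls_def Dra_plus Dra_compl Dra_comp Dra_conv Dra_id Fmd1_comp_in_Dra ra_congruence_Dra)
qed

end
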